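(* Let $X=\{X(t),t\in T\}$ be a max-i.d. process with $\operatorname{essinf}X(t)=0$ for all $t\in T$. Let $\{f_t^{(i)},t\in T\}$, $i=1,2$, be two minimal spectral representations of $X$ defined on $\sigma$-finite measure spaces $(\Omega_i,\mathcal B_i,\mu_i)$, $i=1,2$. (i) If $(\Omega_1,\mathcal B_1,\mu_1)$ is a $\sigma$-finite Borel space, then there is a measurable map $\Phi:\Omega_2\to\Omega_1$ such that $\mu_1=\mu_2\circ\Phi^{-1}$ and for all $t\in T$, $$f_t^{(2)}(\omega)=f_t^{(1)}\circ\Phi(\omega)\quad\text{for }\mu_2\text{-a.a. }\omega\in\Omega_2.$$ (ii) If both $(\Omega_i,\mathcal B_i,\mu_i)$, $i=1,2$, are $\sigma$-finite Borel spaces, then the mapping $\Phi$ in part (i) is a measure space isomorphism and it is unique modulo null sets.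
   Context: $\stackrel{d}{=}$ denotes equality of finite-dimensional distributions. A real-valued process $X=\{X(t),t\in T\}$ on an arbitrary index set $T$ is max-infinitely divisible (max-i.d.) if for every $n\in\mathbb N$ there are i.i.d. processes $\{X_{i,n}(t),t\in T\}$, $i=1,\dots,n$, with $\{X(t),t\in T\}\stackrel{d}{=}\{\max_{1\le i\le n}X_{i,n}(t),t\in T\}$. For a $\sigma$-finite measure space $(\Omega,\mathcal B,\mu)$, $\mathcal L^\vee=\mathcal L^\vee(\Omega,\mathcal B,\mu)$ is the set of measurable $f:\Omega\to\mathbb R$ with $f\ge0$ $\mu$-a.e. and $\mu\{f>a\}<\infty$ for all $a>0$ (functions equal $\mu$-a.e. are identified). Let $\Pi_\mu=\{U_i,i\in J\}$ be a Poisson point process on $(\Omega,\mathcal B)$ with intensity $\mu$. For $f\in\mathcal L^\vee$ put $I(f):=\sup_{i\in J}f(U_i)$, interpreted as $0$ if $\Pi_\mu$ is empty. A family $\{f_t,t\in T\}\subset\mathcal L^\vee(\Omega,\mathcal B,\mu)$ is a spectral representation of $X$ if $\{X(t),t\in T\}\stackrel{d}{=}\{I(f_t),t\in T\}$. It is minimal if (a) for every $B\in\mathcal B$ there is $A\in\sigma\{f_t,t\in T\}$ with $\mu(A\Delta B)=0$; and (b) there is no $B\in\mathcal B$ with $\mu(B)>0$ such that for every $t\in T$, $f_t=0$ $\mu$-a.e. on $B$. A measurable space is a Borel space if it is isomorphic (via a bimeasurable bijection) to a complete separable metric space with its Borel $\sigma$-algebra; endowed with a $\sigma$-finite measure it is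 a $\sigma$-finite Borel space. A measure space isomorphism (modulo null sets) between $(\Omega,\mathcal B,\mu)$ and $(\Omega',\mathcal B',\mu')$ is a bijection $\Phi:\Omega\setminus A\to\Omega'\setminus A'$, with $A\in\mathcal B$, $A'\in\mathcal B'$ null sets, such that $\Phi,\Phi^{-1}$ are measurable and $\mu(E)=\mu'(\Phi(E))$ for all measurable $E\subset\Omega\setminus A$. Two isomorphisms are equal modulo null sets if they agree $\mu$-a.e. *)

theory Defs
  imports "HOL-Probability.Probability"
begin

definition stochastic_process :: "'p measure \<Rightarrow> 't set \<Rightarrow> ('t \<Rightarrow> 'p \<Rightarrow> real) \<Rightarrow> bool" where
  "stochastic_process P T X \<longleftrightarrow> prob_space P \<and> (\<forall>t\<in>T. X t \<in> borel_measurable P)"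

definition fdd_eq ::
  "'t set \<Rightarrow> 'p measure \<Rightarrow> ('t \<Rightarrow> 'p \<Rightarrow> real) \<Rightarrow> 'q measure \<Rightarrow> ('t \<Rightarrow> 'q \<Rightarrow> real) \<Rightarrow> bool" where
  "fdd_eq T P X Q Y \<longleftrightarrow>
     (\<forall>F. finite F \<and> F \<subseteq> T \<longrightarrow>
        distr P (\<Pi>\<^sub>M t\<in>F. borel) (\<lambda>\<omega>. \<lambda>t\<in>F. X t \<omega>) =
        distr Q (\<Pi>\<^sub>M t\<in>F. borel) (\<lambda>\<omega>. \<lambda>t\<in>F. Y t \<omega>))"

definition iid_processes ::
  "'q measure \<Rightarrow> 't set \<Rightarrow> 'i set \<Rightarrow> ('i \<Rightarrow> 't \<Rightarrow> 'q \<Rightarrow> real) \<Rightarrow> bool" where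
  "iid_processes Q T I Y \<longleftrightarrow>
     prob_space Q \<and>
     prob_space.indep_vars Q (\<lambda>_. \<Pi>\<^sub>M t\<in>T. borel) (\<lambda>i \<omega>. \<lambda>t\<in>T. Y i t \<omega>) I \<and>
     (\<forall>i\<in>I. \<forall>j\<in>I. fdd_eq T Q (Y i) Q (Y j))"

text \<open>
  The type of the probability space carrying the \<open>n\<close> i.i.d. processes is no restriction: processes
  defined on any probability space can be replaced by the coordinate processes on the path space
  \<open>\<Pi>\<^sub>M i\<in>{1..n}. \<Pi>\<^sub>M t\<in>T. borel\<close> with their joint law.
\<close>

definition max_id :: "'p measure \<Rightarrow> 't set \<Rightarrow> ('t \<Rightarrow> 'p \<Rightarrow> real) \<Rightarrow> bool" where
  "max_id P T X \<longleftrightarrow>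
     stochastic_process P T X \<and>
     (\<forall>n::nat. n \<ge> 1 \<longrightarrow> (\<exists>(Q :: (nat \<Rightarrow> 't \<Rightarrow> real) measure) Y.
        iid_processes Q T {1..n} Y \<and>
        fdd_eq T P X Q (\<lambda>t \<omega>. Max ((\<lambda>i. Y i t \<omega>) ` {1..n}))))"

definition essinf :: "'p measure \<Rightarrow> ('p \<Rightarrow> real) \<Rightarrow> ereal" where
  "essinf P Z = Sup {a. AE \<omega> in P. a \<le> ereal (Z \<omega>)}"

text \<open>
  A point process is given by a random index set \<open>J \<omega> \<subseteq> \<nat>\<close> and points \<open>U \<omega> i\<close>, \<open>i \<in> J \<omega>\<close>; points
  may be repeated, and \<open>U \<omega> i\<close> is irrelevant for \<open>i \<notin> J \<omega>\<close>.
\<close>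

definition point_count ::
  "('q \<Rightarrow> nat set) \<Rightarrow> ('q \<Rightarrow> nat \<Rightarrow> 'w) \<Rightarrow> 'w set \<Rightarrow> 'q \<Rightarrow> ennreal" where
  "point_count J U B \<omega> = emeasure (count_space UNIV) {i \<in> J \<omega>. U \<omega> i \<in> B}"

definition poisson_point_process ::
  "'q measure \<Rightarrow> 'w measure \<Rightarrow> ('q \<Rightarrow> nat set) \<Rightarrow> ('q \<Rightarrow> nat \<Rightarrow> 'w) \<Rightarrow> bool" where
  "poisson_point_process Q M J U \<longleftrightarrow>
     prob_space Q \<and>
     (\<forall>\<omega>\<in>space Q. \<forall>i\<in>J \<omega>. U \<omega> i \<in> space M) \<and>
     (\<forall>B\<in>sets M. point_count J U B \<in> borel_measurable Q) \<and>
     (\<forall>B\<in>sets M. emeasure M B < \<infinity> \<longrightarrow>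
        (\<forall>k. measure Q {\<omega>\<in>space Q. point_count J U B \<omega> = of_nat k} =
             exp (- measure M B) * measure M B ^ k / fact k)) \<and>
     (\<forall>B\<in>sets M. emeasure M B = \<infinity> \<longrightarrow> (AE \<omega> in Q. point_count J U B \<omega> = \<infinity>)) \<and>
     (\<forall>(n::nat) B. (\<forall>k<n. B k \<in> sets M) \<and> disjoint_family_on B {..<n} \<longrightarrow>
        prob_space.indep_vars Q (\<lambda>_. borel) (\<lambda>k. point_count J U (B k)) {..<n})"

definition Lvee :: "'w measure \<Rightarrow> ('w \<Rightarrow> real) set" where
  "Lvee M = {f \<in> borel_measurable M.
     (AE w in M. 0 \<le> f w) \<and> (\<forall>a>0. emeasure M {w\<in>space M. f w > a} < \<infinity>)}"

text \<open>
  For \<open>f \<in> Lvee M\<close> and a Poisson process with intensity \<open>M\<close>, the set of values is almost surely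
  bounded above, so the real supremum has an unintended value only on a null event.
\<close>

definition extremal_integral ::
  "('q \<Rightarrow> nat set) \<Rightarrow> ('q \<Rightarrow> nat \<Rightarrow> 'w) \<Rightarrow> ('w \<Rightarrow> real) \<Rightarrow> 'q \<Rightarrow> real" where
  "extremal_integral J U f \<omega> = (if J \<omega> = {} then 0 else SUP i\<in>J \<omega>. f (U \<omega> i))"

definition spectral_representation ::
  "'p measure \<Rightarrow> 't set \<Rightarrow> ('t \<Rightarrow> 'p \<Rightarrow> real) \<Rightarrow>
   'q measure \<Rightarrow> ('q \<Rightarrow> nat set) \<Rightarrow> ('q \<Rightarrow> nat \<Rightarrow> 'w) \<Rightarrow>
   'w measure \<Rightarrow> ('t \<Rightarrow> 'w \<Rightarrow> real) \<Rightarrow> bool" where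
  "spectral_representation P T X Q J U M f \<longleftrightarrow>
     (\<forall>t\<in>T. f t \<in> Lvee M) \<and> fdd_eq T P X Q (\<lambda>t. extremal_integral J U (f t))"

definition generated_sigma :: "'w measure \<Rightarrow> 't set \<Rightarrow> ('t \<Rightarrow> 'w \<Rightarrow> real) \<Rightarrow> 'w set set" where
  "generated_sigma M T f =
     sigma_sets (space M) {f t -` S \<inter> space M | t S. t \<in> T \<and> S \<in> sets borel}"

definition minimal_family :: "'w measure \<Rightarrow> 't set \<Rightarrow> ('t \<Rightarrow> 'w \<Rightarrow> real) \<Rightarrow> bool" where
  "minimal_family M T f \<longleftrightarrow>
     (\<forall>B\<in>sets M. \<exists>A\<in>generated_sigma M T f. emeasure M (sym_diff A B) = 0) \<and>
     \<not> (\<exists>B\<in>sets M. emeasure M B > 0 \<and> (\<forall>t\<in>T. AE w in M. w \<in> B \<longrightarrow> f t w = 0))"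

text \<open>
  Taking the carrier \<open>S\<close> of the metric space inside the type of \<open>M\<close> is no restriction, since the
  metric of any space isomorphic to \<open>M\<close> can be transported along the bijection. The metric space is
  required to be nonempty: an empty target space would admit no map from a nonempty null space.
\<close>

definition borel_space :: "'w measure \<Rightarrow> bool" where
  "borel_space M \<longleftrightarrow>
     (\<exists>(S :: 'w set) d g.
        S \<noteq> {} \<and> Metric_space S d \<and> Metric_space.mcomplete S d \<and>
        separable_space (Metric_space.mtopology S d) \<and>
        bij_betw g (space M) S \<and>
        g \<in> M \<rightarrow>\<^sub>M sigma S {V. openin (Metric_space.mtopology S d) V} \<and>
        inv_into (space M) g \<in> sigma S {V. openin (Metric_space.mtopology S d) V} \<rightarrow>\<^sub>M M)"

text \<open>
  Isomorphisms modulo null sets are represented by total functions whose values on the excluded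
  null set \<open>A\<close> are irrelevant.
\<close>

definition iso_mod_null :: "'a measure \<Rightarrow> 'b measure \<Rightarrow> ('a \<Rightarrow> 'b) \<Rightarrow> bool" where
  "iso_mod_null M N \<Phi> \<longleftrightarrow>
     (\<exists>A\<in>null_sets M. \<exists>A'\<in>null_sets N.
        bij_betw \<Phi> (space M - A) (space N - A') \<and>
        \<Phi> \<in> restrict_space M (space M - A) \<rightarrow>\<^sub>M restrict_space N (space N - A') \<and>
        inv_into (space M - A) \<Phi> \<in>
          restrict_space N (space N - A') \<rightarrow>\<^sub>M restrict_space M (space M - A) \<and>
        (\<forall>E\<in>sets M. E \<subseteq> space M - A \<longrightarrow> emeasure M E = emeasure N (\<Phi> ` E)))"

definition intertwining_map ::
  "'t set \<Rightarrow> 'a measure \<Rightarrow> ('t \<Rightarrow> 'a \<Rightarrow> real) \<Rightarrow> 'b measure \<Rightarrow> ('t \<Rightarrow> 'b \<Rightarrow> real) \<Rightarrow> ('b \<Rightarrow> 'a) \<Rightarrow> bool"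
  where
  "intertwining_map T M1 f1 M2 f2 \<Phi> \<longleftrightarrow>
     \<Phi> \<in> M2 \<rightarrow>\<^sub>M M1 \<and> distr M2 M1 \<Phi> = M1 \<and>
     (\<forall>t\<in>T. AE w in M2. f2 t w = f1 t (\<Phi> w))"

end

theory Submission
  imports Defs
begin

text \<open>
  Write \<open>E k = {f t > a}\<close> for the level sets of a spectral representation, indexed by the pairs
  \<open>k = (t, a)\<close> with \<open>t \<in> T\<close> and \<open>a > 0\<close>. Let \<open>F\<close> be a finite set of such pairs. Up to null events,
  the extremal integral of \<open>f t\<close> is at most \<open>a\<close> for all \<open>(t, a)\<close> in \<open>F\<close> if and only if no Poisson
  point falls into \<open>\<Union>k\<in>F. E k\<close>, and the latter event has probability
  \<open>exp (- \<mu> (\<Union>k\<in>F. E k))\<close>. Hence the finite-dimensional distributions of \<open>X\<close> determine the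
  measures of all finite unions of level sets (\<open>spectral_representations_level_sets\<close>), and the rest
  of the argument is about two families of sets whose finite unions have equal measures.

  Attach to each point \<open>w\<close> the set \<open>{k. w \<in> E k}\<close> of indices, regarded as a point of a product of
  two-point spaces. Differences of measures of finite unions and a \<open>\<pi>\<close>-system argument show that the
  two representations induce the same measure \<open>\<lambda>\<close> on this product (\<open>membership_law_cong\<close>). The
  measure \<open>\<lambda>\<close> may be infinite, while its restriction to the index sets that hit a given finite set is
  finite, so the argument needs countably many level sets that cover both spaces up to null
  sets; full support of a minimal family gives them (\<open>minimal_family_countable_cover\<close>).

  The other half of minimality says that the index set determines the point: the level sets generate
  all measurable sets up to null sets (\<open>minimal_family_generates\<close>). On a Borel space this turns into
  a measurable map \<open>h\<close> that recovers almost every point from its index set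
  (\<open>borel_space_retraction\<close>). Then \<open>\<Phi>\<close> sends a point of the second space to its index set and applies
  \<open>h\<close>. Since both index maps have law \<open>\<lambda>\<close>, every almost sure relation between \<open>h\<close> and the index set
  carries over from the first space to the second, so \<open>\<Phi>\<close> preserves the measures and pulls the level
  sets of \<open>f1\<close> back to those of \<open>f2\<close>. The product has one factor for every pair \<open>(t, a)\<close>, so an
  uncountable \<open>T\<close> requires no separate treatment.

  Two maps that preserve the measures and have the same pullbacks of level sets have almost surely
  the same pullback of every measurable set, and agree almost everywhere if countably many measurable
  sets separate the points of the target (\<open>point_map_unique\<close>). This gives uniqueness. If both spaces
  are Borel, it also shows that \<open>\<Phi>\<close> and a map in the opposite direction compose to the identity almost
  everywhere on either side, so that \<open>\<Phi>\<close> is an isomorphism modulo null sets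
  (\<open>inverse_pair_iso_mod_null\<close>).
\<close>

section \<open>Index sets of points and their law\<close>

text \<open>
  The product \<open>\<sigma>\<close>-algebra on \<open>{0,1}\<^sup>K\<close>, with the points of \<open>{0,1}\<^sup>K\<close> written as subsets of \<open>K\<close>. The
  index set \<open>K\<close> may be uncountable.
\<close>
definition membership_space :: "'k set \<Rightarrow> 'k set measure" where
  "membership_space K = sigma (Pow K) ((\<lambda>k. {y \<in> Pow K. k \<in> y}) ` K)"

definition membership :: "'k set \<Rightarrow> ('k \<Rightarrow> 'w set) \<Rightarrow> 'w \<Rightarrow> 'k set" where
  "membership K E w = {k \<in> K. w \<in> E k}"

lemma space_membership_space [simp]: "space (membership_space K) = Pow K"
  unfolding membership_space_def by (rule space_measure_of) auto

lemma sets_membership_space: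
  "sets (membership_space K) = sigma_sets (Pow K) ((\<lambda>k. {y \<in> Pow K. k \<in> y}) ` K)"
  unfolding membership_space_def by (rule sets_measure_of) auto

lemma sets_membership_space_member: "k \<in> K \<Longrightarrow> {y \<in> Pow K. k \<in> y} \<in> sets (membership_space K)"
  unfolding sets_membership_space by (rule sigma_sets.Basic) auto

lemma membership_vimage:
  "k \<in> K \<Longrightarrow> E k \<subseteq> space M \<Longrightarrow> membership K E -` {y \<in> Pow K. k \<in> y} \<inter> space M = E k"
  by (auto simp: membership_def)

lemma measurable_membership:
  assumes "\<And>k. k \<in> K \<Longrightarrow> E k \<in> sets M"
  shows "membership K E \<in> M \<rightarrow>\<^sub>M membership_space K"
  unfolding membership_space_def
proof (rule measurable_measure_of)
  show "membership K E \<in> space M \<rightarrow> Pow K" by (auto simp: membership_def)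
  fix A assume "A \<in> (\<lambda>k. {y \<in> Pow K. k \<in> y}) ` K"
  then show "membership K E -` A \<inter> space M \<in> sets M"
    using assms sets.sets_into_space[OF assms] by (auto simp only: membership_vimage)
qed auto

text \<open>
  Taking preimages commutes with generating a \<open>\<sigma>\<close>-algebra, so a set generated by the \<open>E k\<close> depends
  on a point only through the indices of the sets that contain it.
\<close>
lemma sigma_sets_eq_membership_vimage:
  assumes "\<And>k. k \<in> K \<Longrightarrow> E k \<subseteq> space M" and "A \<in> sigma_sets (space M) (E ` K)"
  obtains C where "C \<in> sets (membership_space K)" "A = membership K E -` C \<inter> space M"
proof -
  have "{membership K E -` C \<inter> space M |C. C \<in> sigma_sets (Pow K) ((\<lambda>k. {y \<in> Pow K. k \<in> y}) ` K)}
      = sigma_sets (space M) {membership K E -` C \<inter> space M |C. C \<in> (\<lambda>k. {y \<in> Pow K. k \<in> y}) ` K}"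
    by (rule sigma_sets_vimage_commute) (auto simp: membership_def)
  also have "{membership K E -` C \<inter> space M |C. C \<in> (\<lambda>k. {y \<in> Pow K. k \<in> y}) ` K}
      = (\<lambda>k. membership K E -` {y \<in> Pow K. k \<in> y} \<inter> space M) ` K"
    by blast
  also have "\<dots> = E ` K"
    by (rule image_cong) (simp_all only: membership_vimage assms(1))
  finally show thesis using assms(2) that unfolding sets_membership_space by blast
qed

text \<open>
  The complements of the sets \<open>hits K F\<close> with finite \<open>F\<close> form a \<open>\<pi>\<close>-system containing the whole
  space. This, and the fact that a hitting event pulls back to a union of the \<open>E k\<close>, makes hitting
  events the right test sets.
\<close>
definition hits :: "'k set \<Rightarrow> 'k set \<Rightarrow> 'k set set" where
  "hits K F = {y \<in> Pow K. y \<inter> F \<noteq> {}}"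

lemma sets_hits:
  assumes "countable F" "F \<subseteq> K" shows "hits K F \<in> sets (membership_space K)"
proof -
  have "hits K F = (\<Union>k\<in>F. {y \<in> Pow K. k \<in> y})" by (auto simp: hits_def)
  also have "\<dots> \<in> sets (membership_space K)"
    using assms(2) by (intro sets.countable_UN''[OF assms(1)] sets_membership_space_member) blast
  finally show ?thesis .
qed

lemma emeasure_membership_hits:
  assumes "\<And>k. k \<in> K \<Longrightarrow> E k \<in> sets M" and "countable F" "F \<subseteq> K"
  shows "emeasure (distr M (membership_space K) (membership K E)) (hits K F) = emeasure M (\<Union>k\<in>F. E k)"
proof -
  have "membership K E -` hits K F \<inter> space M = (\<Union>k\<in>F. E k)"
    using assms(3) sets.sets_into_space[OF assms(1)] by (auto simp: hits_def membership_def)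
  then show ?thesis
    using emeasure_distr[OF measurable_membership[OF assms(1)] sets_hits[OF assms(2,3)]] by simp
qed

lemma sigma_sets_misses:
  "sets (membership_space K) = sigma_sets (Pow K) ((\<lambda>F. Pow K - hits K F) ` {F. finite F \<and> F \<subseteq> K})"
    (is "_ = sigma_sets _ ?G")
proof
  interpret S: sigma_algebra "Pow K" "sigma_sets (Pow K) ?G"
    by (rule sigma_algebra_sigma_sets) auto
  have "{y \<in> Pow K. k \<in> y} \<in> sigma_sets (Pow K) ?G" if "k \<in> K" for k
  proof -
    have "Pow K - (Pow K - hits K {k}) \<in> sigma_sets (Pow K) ?G"
      using that by (intro S.compl_sets sigma_sets.Basic) auto
    also have "Pow K - (Pow K - hits K {k}) = {y \<in> Pow K. k \<in> y}" by (auto simp: hits_def)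
    finally show ?thesis .
  qed
  then show "sets (membership_space K) \<subseteq> sigma_sets (Pow K) ?G"
    unfolding sets_membership_space by (intro S.sigma_sets_subset) auto
  have "?G \<subseteq> sets (membership_space K)"
    using sets.compl_sets[of _ "membership_space K"] by (auto intro!: sets_hits countable_finite)
  then show "sigma_sets (Pow K) ?G \<subseteq> sets (membership_space K)"
    using sets.sigma_sets_subset[of ?G "membership_space K"] by simp
qed

text \<open>
  The hitting functional \<open>F \<mapsto> \<mu> (\<Union>k\<in>F. E k)\<close> determines the law of the index set: for finite \<open>A\<close> and
  \<open>F\<close>, the set of those \<open>y\<close> that hit \<open>A\<close> but miss \<open>F\<close> has measure
  \<open>\<mu> (\<Union>k\<in>A \<union> F. E k) - \<mu> (\<Union>k\<in>F. E k)\<close>, and the missing events form a \<open>\<pi>\<close>-system. The restriction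
  to hitting \<open>A\<close> keeps the measures finite; the countable cover lets \<open>A\<close> increase until almost
  every index set hits it.
\<close>
lemma membership_law_cong:
  assumes E1: "\<And>k. k \<in> K \<Longrightarrow> E1 k \<in> sets M1" and E2: "\<And>k. k \<in> K \<Longrightarrow> E2 k \<in> sets M2"
    and fin: "\<And>k. k \<in> K \<Longrightarrow> emeasure M1 (E1 k) < \<infinity>"
    and eq: "\<And>F. finite F \<Longrightarrow> F \<subseteq> K \<Longrightarrow> emeasure M1 (\<Union>k\<in>F. E1 k) = emeasure M2 (\<Union>k\<in>F. E2 k)"
    and C: "countable C" "C \<subseteq> K"
    and cover1: "AE w in M1. \<exists>k\<in>C. w \<in> E1 k" and cover2: "AE w in M2. \<exists>k\<in>C. w \<in> E2 k"
  shows "distr M1 (membership_space K) (membership K E1) = distr M2 (membership_space K) (membership K E2)"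
    (is "?L1 = ?L2")
proof -
  have hit1: "emeasure ?L1 (hits K F) = emeasure M1 (\<Union>k\<in>F. E1 k)" if "finite F" "F \<subseteq> K" for F
    using that emeasure_membership_hits[of K E1 M1, OF E1] countable_finite by blast
  have hit2: "emeasure ?L2 (hits K F) = emeasure M2 (\<Union>k\<in>F. E2 k)" if "finite F" "F \<subseteq> K" for F
    using that emeasure_membership_hits[of K E2 M2, OF E2] countable_finite by blast
  have hiteq: "emeasure ?L1 (hits K F) = emeasure ?L2 (hits K F)" if "finite F" "F \<subseteq> K" for F
    using hit1[OF that] hit2[OF that] eq[OF that] by simp
  have hitfin: "emeasure ?L1 (hits K F) \<noteq> \<infinity>" if "finite F" "F \<subseteq> K" for F
  proof -
    have "emeasure M1 (\<Union>k\<in>F. E1 k) \<le> (\<Sum>k\<in>F. emeasure M1 (E1 k))"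
      using that E1 by (intro emeasure_subadditive_finite) auto
    also have "\<dots> < \<infinity>" using that fin by (auto simp: less_top)
    finally show ?thesis using hit1[OF that] by simp
  qed
  have sh: "hits K F \<in> sets (membership_space K)" if "finite F" "F \<subseteq> K" for F
    using that by (intro sets_hits countable_finite)
  have local_eq: "emeasure ?L1 (hits K A \<inter> B) = emeasure ?L2 (hits K A \<inter> B)"
    if A: "finite A" "A \<subseteq> K" and B: "B \<in> sets (membership_space K)" for A B
  proof -
    let ?G = "(\<lambda>F. Pow K - hits K F) ` {F. finite F \<and> F \<subseteq> K}"
    have "density ?L1 (indicator (hits K A)) = density ?L2 (indicator (hits K A))"
    proof (rule measure_eqI_generator_eq[where \<Omega> = "Pow K" and E = ?G and A = "\<lambda>_. Pow K"])
      show "Int_stable ?G"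
      proof (rule Int_stableI, clarify)
        fix F F' assume "finite F" "F \<subseteq> K" "finite F'" "F' \<subseteq> K"
        then show "(Pow K - hits K F) \<inter> (Pow K - hits K F') \<in> ?G"
          by (intro image_eqI[where x = "F \<union> F'"]) (auto simp: hits_def)
      qed
      show "?G \<subseteq> Pow (Pow K)" by auto
      fix X assume "X \<in> ?G"
      then obtain F where F: "finite F" "F \<subseteq> K" "X = Pow K - hits K F" by auto
      have X: "X \<in> sets (membership_space K)" using F sh sets.compl_sets[of _ "membership_space K"] by auto
      have sub: "hits K F \<subseteq> hits K (A \<union> F)" by (auto simp: hits_def)
      have HX: "hits K A \<inter> X = hits K (A \<union> F) - hits K F" unfolding F(3) by (auto simp: hits_def)
      have "emeasure ?L1 (hits K A \<inter> X) = emeasure ?L1 (hits K (A \<union> F)) - emeasure ?L1 (hits K F)"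
        unfolding HX using A F sub hitfin sh by (intro emeasure_Diff) auto
      also have "\<dots> = emeasure ?L2 (hits K (A \<union> F)) - emeasure ?L2 (hits K F)"
        using A F by (simp add: hiteq)
      also have "\<dots> = emeasure ?L2 (hits K A \<inter> X)"
        unfolding HX using A F sub hitfin hiteq[of F] sh by (intro emeasure_Diff[symmetric]) auto
      finally show "emeasure (density ?L1 (indicator (hits K A))) X
          = emeasure (density ?L2 (indicator (hits K A))) X"
        using A X sh by (simp add: emeasure_restricted)
    next
      show "range (\<lambda>_. Pow K) \<subseteq> ?G" by (auto simp: hits_def intro!: image_eqI[of _ _ "{}"])
      have "emeasure (density ?L1 (indicator (hits K A))) (Pow K) = emeasure ?L1 (hits K A \<inter> Pow K)"
        using A sh sets.top[of "membership_space K"] by (intro emeasure_restricted) auto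
      also have "hits K A \<inter> Pow K = hits K A" by (auto simp: hits_def)
      finally show "emeasure (density ?L1 (indicator (hits K A))) (Pow K) \<noteq> \<infinity>"
        using hitfin[OF A] by simp
    qed (use sigma_sets_misses in auto)
    then have "emeasure (density ?L1 (indicator (hits K A))) B = emeasure (density ?L2 (indicator (hits K A))) B"
      by simp
    then show ?thesis using A B sh by (simp add: emeasure_restricted)
  qed
  \<comment> \<open>An increasing sequence of finite sets with union \<open>C\<close>; the enumeration
      allows \<open>C\<close> to be finite or empty.\<close>
  define A where "A n = {k \<in> C. to_nat_on C k < n}" for n
  have A: "finite (A n)" "A n \<subseteq> K" for n
  proof -
    have "finite (to_nat_on C ` A n)" by (rule finite_subset[of _ "{..<n}"]) (auto simp: A_def)
    moreover have "inj_on (to_nat_on C) (A n)"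
      using inj_on_to_nat_on[OF C(1)] by (rule inj_on_subset) (auto simp: A_def)
    ultimately show "finite (A n)" by (rule finite_imageD)
    show "A n \<subseteq> K" using C(2) by (auto simp: A_def)
  qed
  have UA: "(\<Union>n. hits K (A n)) = hits K C"
    by (auto simp: hits_def A_def)
  have exhaust: "emeasure (distr M (membership_space K) (membership K E)) B
      = (SUP n. emeasure (distr M (membership_space K) (membership K E)) (hits K (A n) \<inter> B))"
    if E: "\<And>k. k \<in> K \<Longrightarrow> E k \<in> sets M" and cov: "AE w in M. \<exists>k\<in>C. w \<in> E k"
      and B: "B \<in> sets (membership_space K)" for M :: "'z measure" and E B
  proof -
    let ?L = "distr M (membership_space K) (membership K E)"
    have "AE y in ?L. y \<in> hits K C"
    proof (subst AE_distr_iff)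
      show "AE w in M. membership K E w \<in> hits K C"
        using cov C(2) by (auto simp: hits_def membership_def)
      show "{y \<in> space (membership_space K). y \<in> hits K C} \<in> sets (membership_space K)"
        using sets_hits[OF C] by (rule back_subst) (auto simp: hits_def)
    qed (rule measurable_membership[OF E])
    then have "emeasure ?L B = emeasure ?L (\<Union>n. hits K (A n) \<inter> B)"
      using B UA sets_hits[OF C] by (intro emeasure_eq_AE) (auto simp flip: UN_extend_simps)
    also have "\<dots> = (SUP n. emeasure ?L (hits K (A n) \<inter> B))"
      using A B sh by (intro SUP_emeasure_incseq[symmetric])
        (auto simp: incseq_def hits_def A_def)
    finally show ?thesis .
  qed
  show ?thesis
  proof (rule measure_eqI)
    fix B assume "B \<in> sets ?L1"
    then have B: "B \<in> sets (membership_space K)" by simp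
    show "emeasure ?L1 B = emeasure ?L2 B"
      proof -
      have "emeasure ?L1 B = (SUP n. emeasure ?L1 (hits K (A n) \<inter> B))"
        by (rule exhaust[OF E1 cover1 B])
      also have "\<dots> = (SUP n. emeasure ?L2 (hits K (A n) \<inter> B))"
        by (simp only: local_eq[OF A B])
      also have "\<dots> = emeasure ?L2 B"
        by (rule exhaust[OF E2 cover2 B, symmetric])
      finally show ?thesis .
    qed
  qed simp
qed

section \<open>Measurable maps into a Borel space\<close>

context Metric_space
begin

lemma separable_dense_sequence:
  assumes "separable_space mtopology" "M \<noteq> {}"
  obtains s :: "nat \<Rightarrow> 'a" where "range s \<subseteq> M" "\<And>x r. x \<in> M \<Longrightarrow> 0 < r \<Longrightarrow> \<exists>j. d x (s j) < r"
proof -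
  obtain D where D: "countable D" "D \<subseteq> M" "mtopology closure_of D = M"
    using assms(1) unfolding separable_space_def by auto
  have "D \<noteq> {}" using D(3) assms(2) by auto
  show thesis
  proof (rule that[of "from_nat_into D"])
    show "range (from_nat_into D) \<subseteq> M" using D(2) from_nat_into[OF \<open>D \<noteq> {}\<close>] by auto
    fix x and r :: real assume "x \<in> M" "0 < r"
    then obtain y where "y \<in> D" "y \<in> mball x r" using D(3) unfolding metric_closure_of by blast
    then show "\<exists>j. d x (from_nat_into D j) < r"
      using from_nat_into_surj[OF D(1)] by (metis in_mball)
  qed
qed

text \<open>
  In a separable metric space every open set is a union of balls with radius \<open>1 / (n + 1)\<close> around
  the points of a dense sequence, and there are only countably many such balls. Measurability
  therefore needs to be checked for the real functions \<open>d (H y) (s j)\<close> only.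
\<close>
lemma measurable_into_separable:
  fixes s :: "nat \<Rightarrow> 'a"
  assumes s: "range s \<subseteq> M" "\<And>x r. x \<in> M \<Longrightarrow> 0 < r \<Longrightarrow> \<exists>j. d x (s j) < r"
    and H: "\<And>y. y \<in> space N \<Longrightarrow> H y \<in> M" and dist[measurable]: "\<And>j. (\<lambda>y. d (H y) (s j)) \<in> borel_measurable N"
  shows "H \<in> N \<rightarrow>\<^sub>M sigma M {V. openin mtopology V}"
proof (rule measurable_measure_of)
  show "{V. openin mtopology V} \<subseteq> Pow M" using openin_subset by fastforce
  fix V assume "V \<in> {V. openin mtopology V}"
  then have V: "V \<subseteq> M" "\<And>x. x \<in> V \<Longrightarrow> \<exists>r>0. mball x r \<subseteq> V" unfolding openin_mtopology by auto
  let ?I = "{(j, n). mball (s j) (1 / Suc n) \<subseteq> V}"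
  have "H -` V \<inter> space N = (\<Union>(j, n)\<in>?I. {y \<in> space N. d (H y) (s j) < 1 / Suc n})"
  proof (intro equalityI subsetI)
    fix y assume y: "y \<in> H -` V \<inter> space N"
    then obtain r where r: "r > 0" "mball (H y) r \<subseteq> V" using V(2) by auto
    obtain n where n: "1 / Suc n < r / 2" using nat_approx_posE[of "r / 2"] r by auto
    obtain j where j: "d (H y) (s j) < 1 / Suc n" using s(2)[of "H y" "1 / Suc n"] H y by auto
    have "mball (s j) (1 / Suc n) \<subseteq> mball (H y) r"
    proof
      fix z assume z: "z \<in> mball (s j) (1 / Suc n)"
      then have "d (H y) z \<le> d (H y) (s j) + d (s j) z" using H y s(1) by (intro triangle) auto
      then show "z \<in> mball (H y) r" using z j n H y by auto
    qed
    then show "y \<in> (\<Union>(j, n)\<in>?I. {y \<in> space N. d (H y) (s j) < 1 / Suc n})"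
      using r j y by auto
  next
    fix y assume "y \<in> (\<Union>(j, n)\<in>?I. {y \<in> space N. d (H y) (s j) < 1 / Suc n})"
    then obtain j n where jn: "mball (s j) (1 / Suc n) \<subseteq> V" "y \<in> space N" "d (H y) (s j) < 1 / Suc n" by auto
    then have "H y \<in> mball (s j) (1 / Suc n)" using H s(1) by (auto simp: commute)
    then show "y \<in> H -` V \<inter> space N" using jn by auto
  qed
  also have "\<dots> \<in> sets N"
    by (intro sets.countable_UN'') auto
  finally show "H -` V \<inter> space N \<in> sets N" .
qed (use H in auto)

end

text \<open>
  The form in which the Borel space property is applied: a dense sequence \<open>s\<close> in the metric model, and
  the preimages of the balls around its points as measurable sets.
\<close>
lemma borel_space_obtain:
  assumes "borel_space (M :: 'w measure)"
  obtains S :: "'w set" and d and s :: "nat \<Rightarrow> 'w" and g where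
    "Metric_space S d" "Metric_space.mcomplete S d" "range s \<subseteq> S"
    "\<And>x r. x \<in> S \<Longrightarrow> 0 < r \<Longrightarrow> \<exists>j. d x (s j) < r"
    "bij_betw g (space M) S"
    "inv_into (space M) g \<in> sigma S {V. openin (Metric_space.mtopology S d) V} \<rightarrow>\<^sub>M M"
    "\<And>j r. {w \<in> space M. d (g w) (s j) < r} \<in> sets M"
proof -
  obtain S :: "'w set" and d g where S: "S \<noteq> {}" "Metric_space S d" "Metric_space.mcomplete S d"
      "separable_space (Metric_space.mtopology S d)" "bij_betw g (space M) S"
      "g \<in> M \<rightarrow>\<^sub>M sigma S {V. openin (Metric_space.mtopology S d) V}"
      "inv_into (space M) g \<in> sigma S {V. openin (Metric_space.mtopology S d) V} \<rightarrow>\<^sub>M M"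
    using assms unfolding borel_space_def by metis
  interpret Metric_space S d by fact
  obtain s :: "nat \<Rightarrow> 'w" where s: "range s \<subseteq> S" "\<And>x r. x \<in> S \<Longrightarrow> 0 < r \<Longrightarrow> \<exists>j. d x (s j) < r"
    using separable_dense_sequence[OF S(4,1)] by metis
  have gS: "g w \<in> S" if "w \<in> space M" for w using S(5) that by (auto dest: bij_betwE)
  have balls: "{w \<in> space M. d (g w) (s j) < r} \<in> sets M" for j r
  proof -
    have "mball (s j) r \<in> sets (sigma S {V. openin mtopology V})"
    proof (subst sets_measure_of)
      show "{V. openin mtopology V} \<subseteq> Pow S" using openin_subset by fastforce
    qed (auto intro: sigma_sets.Basic)
    then have "g -` mball (s j) r \<inter> space M \<in> sets M" by (rule measurable_sets[OF S(6)])
    also have "g -` mball (s j) r \<inter> space M = {w \<in> space M. d (g w) (s j) < r}"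
      using gS range_subsetD[OF s(1)] by (auto simp: commute)
    finally show ?thesis .
  qed
  show thesis by (rule that[of S d s g]) (fact S s balls)+
qed

definition countably_separated :: "'w measure \<Rightarrow> bool" where
  "countably_separated M \<longleftrightarrow> (\<exists>B :: nat \<Rightarrow> 'w set. range B \<subseteq> sets M \<and>
     (\<forall>v\<in>space M. \<forall>w\<in>space M. (\<forall>n. v \<in> B n \<longleftrightarrow> w \<in> B n) \<longrightarrow> v = w))"

text \<open>
  The balls with radius \<open>1 / (n + 1)\<close> around a dense sequence separate points: two points lying in the
  same balls are arbitrarily close to a common \<open>s j\<close>.
\<close>
lemma borel_space_countably_separated:
  assumes "borel_space (M :: 'w measure)"
  shows "countably_separated M"
proof -
  obtain S :: "'w set" and d and s :: "nat \<Rightarrow> 'w" and g where "Metric_space S d"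
    and complete: "Metric_space.mcomplete S d"
    and s: "range s \<subseteq> S" "\<And>x r. x \<in> S \<Longrightarrow> 0 < r \<Longrightarrow> \<exists>j. d x (s j) < r"
    and g: "bij_betw g (space M) S"
    and inv_g: "inv_into (space M) g \<in> sigma S {V. openin (Metric_space.mtopology S d) V} \<rightarrow>\<^sub>M M"
    and balls: "\<And>j r. {w \<in> space M. d (g w) (s j) < r} \<in> sets M"
    by (rule borel_space_obtain[OF assms]) (rule that; assumption)
  interpret Metric_space S d by fact
  let ?B = "\<lambda>n. {w \<in> space M. d (g w) (s (fst (prod_decode n))) < 1 / Suc (snd (prod_decode n))}"
  have "v = w" if v: "v \<in> space M" and w: "w \<in> space M" and eq: "\<And>n. v \<in> ?B n \<longleftrightarrow> w \<in> ?B n" for v w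
  proof -
    have gS: "g v \<in> S" "g w \<in> S" using g v w by (auto dest: bij_betwE)
    have "d (g v) (g w) \<le> 0"
    proof (rule field_le_epsilon)
      fix e :: real assume e: "0 < e"
      obtain n where n: "1 / Suc n < e / 2" using nat_approx_posE[of "e / 2"] e by auto
      obtain j where j: "d (g v) (s j) < 1 / Suc n" using s(2)[of "g v" "1 / Suc n"] gS by auto
      have "d (g w) (s j) < 1 / Suc n" using eq[of "prod_encode (j, n)"] j v w by simp
      then show "d (g v) (g w) \<le> 0 + e"
        using triangle[of "g v" "s j" "g w"] gS range_subsetD[OF s(1), of j] j n
          commute[of "g w" "s j"] by linarith
    qed
    then have "g v = g w" using gS by (metis nonneg order_antisym zero)
    then show "v = w" using g v w by (auto simp: bij_betw_def inj_on_def)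
  qed
  then show ?thesis unfolding countably_separated_def using balls by (intro exI[of _ ?B]) blast
qed

text \<open>
  If \<open>c\<close> generates all measurable sets up to null sets, then it can be inverted almost everywhere by
  a measurable map. In the metric model, whether \<open>w\<close> lies in the ball of radius \<open>\<epsilon> n\<close> around \<open>s j\<close>
  is decided almost surely by whether \<open>c w\<close> lies in some measurable set \<open>C n j\<close>. The first \<open>j\<close> with
  \<open>y \<in> C n j\<close> gives an approximation \<open>u n y\<close> of the point to be recovered from \<open>y\<close>, and
  completeness provides the limit.
\<close>
lemma borel_space_retraction:
  assumes M: "borel_space (M :: 'w measure)" and c: "c \<in> M \<rightarrow>\<^sub>M N"
    and dense: "\<And>B. B \<in> sets M \<Longrightarrow> \<exists>C\<in>sets N. AE w in M. w \<in> B \<longleftrightarrow> c w \<in> C"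
  obtains h where "h \<in> N \<rightarrow>\<^sub>M M" "AE w in M. h (c w) = w"
proof -
  obtain S :: "'w set" and d and s :: "nat \<Rightarrow> 'w" and g where "Metric_space S d"
    and complete: "Metric_space.mcomplete S d"
    and s: "range s \<subseteq> S" "\<And>x r. x \<in> S \<Longrightarrow> 0 < r \<Longrightarrow> \<exists>j. d x (s j) < r"
    and g: "bij_betw g (space M) S"
    and inv_g: "inv_into (space M) g \<in> sigma S {V. openin (Metric_space.mtopology S d) V} \<rightarrow>\<^sub>M M"
    and balls: "\<And>j r. {w \<in> space M. d (g w) (s j) < r} \<in> sets M"
    by (rule borel_space_obtain[OF M]) (rule that; assumption)
  interpret Metric_space S d by fact
  have sS: "s j \<in> S" for j using s(1) by auto
  define \<epsilon> where "\<epsilon> n = 1 / real (Suc n)" for n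
  have \<epsilon>: "\<epsilon> n > 0" for n by (simp add: \<epsilon>_def)
  define C where "C n j = (SOME C. C \<in> sets N \<and>
      (AE w in M. w \<in> {w \<in> space M. d (g w) (s j) < \<epsilon> n} \<longleftrightarrow> c w \<in> C))" for n j
  have C_spec: "C n j \<in> sets N \<and>
      (AE w in M. w \<in> {w \<in> space M. d (g w) (s j) < \<epsilon> n} \<longleftrightarrow> c w \<in> C n j)" for n j
    unfolding C_def by (rule someI_ex) (use dense[OF balls[where j = j and r = "\<epsilon> n"]] in blast)
  have C[measurable]: "C n j \<in> sets N" for n j using C_spec by blast
  have C_ae: "AE w in M. w \<in> {w \<in> space M. d (g w) (s j) < \<epsilon> n} \<longleftrightarrow> c w \<in> C n j" for n j
    using C_spec by blast
  define J where "J n y = (LEAST j. y \<in> C n j)" for n y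
  have J[measurable]: "J n \<in> N \<rightarrow>\<^sub>M count_space UNIV" for n unfolding J_def by measurable
  define u where "u n y = s (J n y)" for n y
  have uS: "u n y \<in> S" for n y by (simp add: u_def sS)
  have [measurable]: "(\<lambda>y. d (u n y) a) \<in> borel_measurable N" for n a
    unfolding u_def by (rule measurable_compose[OF J]) simp
  have [measurable]: "(\<lambda>y. d (u n y) (u m y)) \<in> borel_measurable N" for n m
    unfolding u_def
    by (rule measurable_compose_countable[where f = "\<lambda>i y. d (s i) (s (J m y))", OF _ J],
        rule measurable_compose[OF J]) simp
  \<comment> \<open>Approximations of one point with errors below \<open>\<epsilon> n\<close> and \<open>\<epsilon> m\<close> satisfy this bound, which makes
      the sequence Cauchy. Elsewhere a default point of \<open>S\<close> is used.\<close>
  define good where "good y \<longleftrightarrow> (\<forall>n m. d (u n y) (u m y) \<le> \<epsilon> n + \<epsilon> m)" for y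
  have [measurable]: "Measurable.pred N good" unfolding good_def by measurable
  have \<epsilon>_lim: "\<epsilon> \<longlonglongrightarrow> 0" unfolding \<epsilon>_def using LIMSEQ_inverse_real_of_nat by (simp add: inverse_eq_divide)
  have lim: "\<exists>p\<in>S. (\<lambda>n. d (u n y) p) \<longlonglongrightarrow> 0" if "good y" for y
  proof -
    have "MCauchy (\<lambda>n. u n y)" unfolding MCauchy_def
    proof (intro conjI allI impI)
      show "range (\<lambda>n. u n y) \<subseteq> S" using uS by auto
      fix e :: real assume "0 < e"
      then obtain N where N: "\<And>n. n \<ge> N \<Longrightarrow> \<epsilon> n < e / 2"
        using order_tendstoD(2)[OF \<epsilon>_lim, of "e / 2"] by (auto simp: eventually_sequentially)
      have "d (u n y) (u m y) < e" if "N \<le> n" "N \<le> m" for n m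
        using \<open>good y\<close> N[OF that(1)] N[OF that(2)] unfolding good_def
        by (smt (verit) field_sum_of_halves)
      then show "\<exists>N. \<forall>n n'. N \<le> n \<longrightarrow> N \<le> n' \<longrightarrow> d (u n y) (u n' y) < e" by blast
    qed
    then obtain p where p: "limitin mtopology (\<lambda>n. u n y) p sequentially"
      using complete unfolding mcomplete_def by blast
    have "(\<lambda>n. d (u n y) p) \<longlonglongrightarrow> 0"
      using p unfolding limit_metric_sequentially LIMSEQ_iff by simp blast
    then show ?thesis using p unfolding limit_metric_sequentially by blast
  qed
  define H where "H y = (if good y then SOME p. p \<in> S \<and> (\<lambda>n. d (u n y) p) \<longlonglongrightarrow> 0 else s 0)" for y
  have H: "H y \<in> S \<and> (\<lambda>n. d (u n y) (H y)) \<longlonglongrightarrow> 0" if "good y" for y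
    using someI_ex[OF lim[OF that, unfolded Bex_def]] that by (simp add: H_def)
  have HS: "H y \<in> S" for y using H sS by (cases "good y") (auto simp: H_def)
  have "H \<in> N \<rightarrow>\<^sub>M sigma S {V. openin mtopology V}"
  proof (rule measurable_into_separable[OF s HS])
    fix j
    show "(\<lambda>y. d (H y) (s j)) \<in> borel_measurable N"
    proof (rule borel_measurable_LIMSEQ_real)
      fix y
      show "(\<lambda>n. if good y then d (u n y) (s j) else d (s 0) (s j)) \<longlonglongrightarrow> d (H y) (s j)"
      proof (cases "good y")
        case True
        have abs: "norm (d (u n y) (s j) - d (H y) (s j)) \<le> d (u n y) (H y)" for n
          using triangle[OF uS[of n y] HS[of y] sS[of j]] triangle[OF HS[of y] uS[of n y] sS[of j]]
            commute[of "H y" "u n y"] unfolding real_norm_def abs_le_iff by linarith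
        have "(\<lambda>n. d (u n y) (s j) - d (H y) (s j)) \<longlonglongrightarrow> 0"
          by (rule Lim_null_comparison[OF always_eventually[OF allI[OF abs]]])
            (use H[OF True] in blast)
        then show ?thesis using True by (simp add: LIM_zero_iff)
      qed (simp add: H_def)
    next
      show "(\<lambda>y. if good y then d (u n y) (s j) else d (s 0) (s j)) \<in> borel_measurable N" for n
        by measurable
    qed
  qed
  then have "inv_into (space M) g \<circ> H \<in> N \<rightarrow>\<^sub>M M" using inv_g by (rule measurable_comp)
  moreover have "AE w in M. (inv_into (space M) g \<circ> H) (c w) = w"
  proof -
    have "AE w in M. \<forall>n j. w \<in> {w \<in> space M. d (g w) (s j) < \<epsilon> n} \<longleftrightarrow> c w \<in> C n j"
      using C_ae by (simp add: AE_all_countable)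
    then show ?thesis
    proof (rule AE_mp, intro AE_I2 impI)
      fix w assume w: "w \<in> space M"
        and eq: "\<forall>n j. w \<in> {w \<in> space M. d (g w) (s j) < \<epsilon> n} \<longleftrightarrow> c w \<in> C n j"
      have gw: "g w \<in> S" using g w by (auto dest: bij_betwE)
      have near: "d (u n (c w)) (g w) < \<epsilon> n" for n
      proof -
        have "\<exists>j. c w \<in> C n j" using s(2)[OF gw \<epsilon>, of n] eq w by auto
        then have "c w \<in> C n (J n (c w))" unfolding J_def by (rule LeastI_ex)
        then have "w \<in> {w \<in> space M. d (g w) (s (J n (c w))) < \<epsilon> n}" using eq by blast
        then show ?thesis by (simp add: u_def commute)
      qed
      have "good (c w)" unfolding good_def
      proof (intro allI)
        fix n m
        show "d (u n (c w)) (u m (c w)) \<le> \<epsilon> n + \<epsilon> m"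
          using triangle[of "u n (c w)" "g w" "u m (c w)"] near[of n] near[of m] uS gw
          by (simp add: commute)
      qed
      have "d (H (c w)) (g w) \<le> d (u n (c w)) (H (c w)) + \<epsilon> n" for n
        using triangle[of "H (c w)" "u n (c w)" "g w"] near[of n] uS HS gw by (simp add: commute)
      moreover have "(\<lambda>n. d (u n (c w)) (H (c w)) + \<epsilon> n) \<longlonglongrightarrow> 0"
        using tendsto_add[OF _ \<epsilon>_lim, of _ 0] H[OF \<open>good (c w)\<close>] by simp
      ultimately have "d (H (c w)) (g w) \<le> 0" by (intro LIMSEQ_le_const) auto
      then have "H (c w) = g w" using HS gw by (metis nonneg order_antisym zero)
      then show "(inv_into (space M) g \<circ> H) (c w) = w"
        using g w by (simp add: bij_betw_def)
    qed
  qed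
  ultimately show thesis by (rule that)
qed

section \<open>Point maps determined by a family of sets\<close>

text \<open>
  Equality up to null sets is stated with the almost everywhere quantifier, which composes better
  than null symmetric differences.
\<close>
definition generates_mod_null :: "'w measure \<Rightarrow> 'k set \<Rightarrow> ('k \<Rightarrow> 'w set) \<Rightarrow> bool" where
  "generates_mod_null M K E \<longleftrightarrow>
     (\<forall>B\<in>sets M. \<exists>A\<in>sigma_sets (space M) (E ` K). AE w in M. w \<in> B \<longleftrightarrow> w \<in> A)"

lemma generates_mod_nullE:
  assumes "generates_mod_null M K E" "B \<in> sets M"
  obtains A where "A \<in> sigma_sets (space M) (E ` K)" "AE w in M. w \<in> B \<longleftrightarrow> w \<in> A"
  using assms unfolding generates_mod_null_def by blast

text \<open>
  The map is \<open>h \<circ> membership K E2\<close>, where \<open>h\<close> recovers a point of \<open>M1\<close> from its index set. All claims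
  concern a fixed measurable property of the pair \<open>(y, h y)\<close> under the common law of the index
  sets, so they follow from the corresponding facts on \<open>M1\<close>, where \<open>h (membership K E1 w) = w\<close>.
\<close>
lemma equal_laws_imp_point_map:
  assumes M1: "borel_space M1" and gen: "generates_mod_null M1 K E1"
    and E1: "\<And>k. k \<in> K \<Longrightarrow> E1 k \<in> sets M1" and E2: "\<And>k. k \<in> K \<Longrightarrow> E2 k \<in> sets M2"
    and law: "distr M1 (membership_space K) (membership K E1) = distr M2 (membership_space K) (membership K E2)"
  obtains \<Phi> where "\<Phi> \<in> M2 \<rightarrow>\<^sub>M M1" "distr M2 M1 \<Phi> = M1"
    "\<And>k. k \<in> K \<Longrightarrow> AE w in M2. w \<in> E2 k \<longleftrightarrow> \<Phi> w \<in> E1 k"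
proof -
  note c1 = measurable_membership[of K E1 M1, OF E1] and c2 = measurable_membership[of K E2 M2, OF E2]
  have *: "\<exists>C\<in>sets (membership_space K). AE w in M1. w \<in> B \<longleftrightarrow> membership K E1 w \<in> C" if B: "B \<in> sets M1" for B
  proof -
    obtain A where A: "A \<in> sigma_sets (space M1) (E1 ` K)" "AE w in M1. w \<in> B \<longleftrightarrow> w \<in> A"
      using gen B by (rule generates_mod_nullE)
    obtain C where C: "C \<in> sets (membership_space K)" "A = membership K E1 -` C \<inter> space M1"
      using sets.sets_into_space[OF E1] A(1) by (rule sigma_sets_eq_membership_vimage)
    show ?thesis using A(2) C by (intro bexI[of _ C]) auto
  qed
  obtain h where h: "h \<in> membership_space K \<rightarrow>\<^sub>M M1" "AE w in M1. h (membership K E1 w) = w"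
    by (rule borel_space_retraction[OF M1 c1 *])
  show thesis
  proof (rule that[of "h \<circ> membership K E2"])
    show "h \<circ> membership K E2 \<in> M2 \<rightarrow>\<^sub>M M1" using c2 h(1) by (rule measurable_comp)
    have "distr M2 M1 (h \<circ> membership K E2) = distr (distr M1 (membership_space K) (membership K E1)) M1 h"
      unfolding law by (rule distr_distr[OF h(1) c2, symmetric])
    also have "\<dots> = distr M1 M1 (h \<circ> membership K E1)" by (rule distr_distr[OF h(1) c1])
    also have "\<dots> = distr M1 M1 (\<lambda>w. w)"
      using h(2) measurable_comp[OF c1 h(1)] by (intro distr_cong_AE) (auto simp: comp_def)
    finally show "distr M2 M1 (h \<circ> membership K E2) = M1" by (simp add: distr_id2)
  next
    fix k assume k: "k \<in> K"
    let ?C = "{y \<in> space (membership_space K). k \<in> y \<longleftrightarrow> h y \<in> E1 k}"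
    have C: "?C \<in> sets (membership_space K)"
    proof -
      have "?C = ({y \<in> Pow K. k \<in> y} \<inter> (h -` E1 k \<inter> space (membership_space K)))
          \<union> (space (membership_space K) - {y \<in> Pow K. k \<in> y} - (h -` E1 k \<inter> space (membership_space K)))" by auto
      also have "\<dots> \<in> sets (membership_space K)"
        by (intro sets.Un sets.Int sets.Diff sets.top sets_membership_space_member[OF k] measurable_sets[OF h(1) E1[OF k]])
      finally show ?thesis .
    qed
    have "AE w in M1. k \<in> membership K E1 w \<longleftrightarrow> h (membership K E1 w) \<in> E1 k"
      using h(2) by eventually_elim (use k in \<open>auto simp: membership_def\<close>)
    then have "AE y in distr M1 (membership_space K) (membership K E1). k \<in> y \<longleftrightarrow> h y \<in> E1 k"
      by (subst AE_distr_iff[OF c1 C])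
    then have "AE w in M2. k \<in> membership K E2 w \<longleftrightarrow> h (membership K E2 w) \<in> E1 k"
      unfolding law by (subst (asm) AE_distr_iff[OF c2 C])
    then show "AE w in M2. w \<in> E2 k \<longleftrightarrow> (h \<circ> membership K E2) w \<in> E1 k"
      using k by (auto simp: membership_def)
  qed
qed

lemma AE_preserving:
  assumes \<Phi>: "\<Phi> \<in> M \<rightarrow>\<^sub>M N" "distr M N \<Phi> = N" and P: "AE v in N. P v"
  shows "AE w in M. P (\<Phi> w)"
  by (rule AE_distrD[OF \<Phi>(1)]) (unfold \<Phi>(2), rule P)

text \<open>
  The sets with almost surely equal preimages under \<open>\<Phi>\<close> and \<open>\<Psi>\<close> form a \<open>\<sigma>\<close>-algebra containing the
  \<open>E k\<close>, and they include the null sets because both maps preserve the measure. So the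
  preimages of a separating sequence agree simultaneously outside one null set.
\<close>
lemma point_map_unique:
  assumes gen: "generates_mod_null N K E" and E: "\<And>k. k \<in> K \<Longrightarrow> E k \<in> sets N" and sep: "countably_separated N"
    and \<Phi>: "\<Phi> \<in> M \<rightarrow>\<^sub>M N" "distr M N \<Phi> = N" and \<Psi>: "\<Psi> \<in> M \<rightarrow>\<^sub>M N" "distr M N \<Psi> = N"
    and eq: "\<And>k. k \<in> K \<Longrightarrow> AE w in M. \<Phi> w \<in> E k \<longleftrightarrow> \<Psi> w \<in> E k"
  shows "AE w in M. \<Phi> w = \<Psi> w"
proof -
  have sp: "AE w in M. \<Phi> w \<in> space N \<and> \<Psi> w \<in> space N"
    using \<Phi>(1) \<Psi>(1) by (auto intro!: AE_I2 dest: measurable_space)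
  have gen_eq: "AE w in M. \<Phi> w \<in> A \<longleftrightarrow> \<Psi> w \<in> A" if "A \<in> sigma_sets (space N) (E ` K)" for A
    using that
  proof induction
    case (Basic A)
    then show ?case using eq by blast
  next
    case (Compl A)
    from Compl(2) sp show ?case by eventually_elim auto
  next
    case (Union A)
    from Union(2) have "AE w in M. \<forall>i. \<Phi> w \<in> A i \<longleftrightarrow> \<Psi> w \<in> A i" by (simp add: AE_all_countable)
    then show ?case by eventually_elim auto
  qed simp
  have all_eq: "AE w in M. \<Phi> w \<in> B \<longleftrightarrow> \<Psi> w \<in> B" if B: "B \<in> sets N" for B
  proof -
    obtain A where A: "A \<in> sigma_sets (space N) (E ` K)" "AE v in N. v \<in> B \<longleftrightarrow> v \<in> A"
      using gen B by (rule generates_mod_nullE)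
    from gen_eq[OF A(1)] AE_preserving[OF \<Phi> A(2)] AE_preserving[OF \<Psi> A(2)]
    show ?thesis by eventually_elim auto
  qed
  obtain B :: "nat \<Rightarrow> _ set" where B: "range B \<subseteq> sets N"
      "\<forall>v\<in>space N. \<forall>w\<in>space N. (\<forall>n. v \<in> B n \<longleftrightarrow> w \<in> B n) \<longrightarrow> v = w"
    using sep unfolding countably_separated_def by (elim exE conjE)
  have "AE w in M. \<forall>n. \<Phi> w \<in> B n \<longleftrightarrow> \<Psi> w \<in> B n"
    using all_eq B(1) by (simp add: AE_all_countable range_subsetD)
  then show ?thesis using sp by eventually_elim (use B(2) in simp)
qed

lemma countably_separated_fixpoints:
  assumes "countably_separated M" and \<Theta>: "\<Theta> \<in> M \<rightarrow>\<^sub>M M"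
  shows "{w \<in> space M. \<Theta> w = w} \<in> sets M"
proof -
  obtain B :: "nat \<Rightarrow> _ set" where B: "range B \<subseteq> sets M"
      "\<forall>v\<in>space M. \<forall>w\<in>space M. (\<forall>n. v \<in> B n \<longleftrightarrow> w \<in> B n) \<longrightarrow> v = w"
    using assms(1) unfolding countably_separated_def by (elim exE conjE)
  have [measurable]: "B n \<in> sets M" for n using B(1) by auto
  note \<Theta>[measurable]
  have "\<Theta> w = w \<longleftrightarrow> (\<forall>n. \<Theta> w \<in> B n \<longleftrightarrow> w \<in> B n)" if "w \<in> space M" for w
    using bspec[OF bspec[OF B(2) measurable_space[OF \<Theta> that]] that] by auto
  then have "{w \<in> space M. \<Theta> w = w} = {w \<in> space M. \<forall>n. \<Theta> w \<in> B n \<longleftrightarrow> w \<in> B n}"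
    by auto
  also have "\<dots> \<in> sets M" by measurable
  finally show ?thesis .
qed

text \<open>
  Restrict \<open>\<Phi>\<close> and \<open>\<Psi>\<close> to the sets on which the round trips \<open>\<Psi> \<circ> \<Phi>\<close> and \<open>\<Phi> \<circ> \<Psi>\<close> are the identity.
  These sets are mapped onto each other, and countable separation makes them measurable. The image
  of a measurable set under \<open>\<Phi>\<close> is its preimage under \<open>\<Psi>\<close>, which has the same measure.
\<close>
lemma inverse_pair_iso_mod_null:
  assumes sepM: "countably_separated M" and sepN: "countably_separated N"
    and \<Phi>: "\<Phi> \<in> M \<rightarrow>\<^sub>M N" and \<Psi>: "\<Psi> \<in> N \<rightarrow>\<^sub>M M" "distr N M \<Psi> = M"
    and inv1: "AE w in M. \<Psi> (\<Phi> w) = w" and inv2: "AE v in N. \<Phi> (\<Psi> v) = v"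
  shows "iso_mod_null M N \<Phi>"
proof -
  define D where "D = {w \<in> space M. \<Psi> (\<Phi> w) = w}"
  define D' where "D' = {v \<in> space N. \<Phi> (\<Psi> v) = v}"
  have D: "D \<in> sets M"
    using countably_separated_fixpoints[OF sepM measurable_comp[OF \<Phi> \<Psi>(1)]] by (simp add: D_def)
  have D': "D' \<in> sets N"
    using countably_separated_fixpoints[OF sepN measurable_comp[OF \<Psi>(1) \<Phi>]] by (simp add: D'_def)
  have sub: "space M - (space M - D) = D" "space N - (space N - D') = D'"
    by (auto simp: D_def D'_def)
  have null: "space M - D \<in> null_sets M" "space N - D' \<in> null_sets N"
  proof -
    have "AE w in M. w \<notin> space M - D" using inv1 by eventually_elim (auto simp: D_def)
    then show "space M - D \<in> null_sets M" using D by (subst AE_iff_null_sets) auto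
    have "AE w in N. w \<notin> space N - D'" using inv2 by eventually_elim (auto simp: D'_def)
    then show "space N - D' \<in> null_sets N" using D' by (subst AE_iff_null_sets) auto
  qed
  have maps: "\<Phi> \<in> D \<rightarrow> D'" "\<Psi> \<in> D' \<rightarrow> D"
    using measurable_space[OF \<Phi>] measurable_space[OF \<Psi>(1)] by (auto simp: D_def D'_def)
  have bij: "bij_betw \<Phi> D D'"
    by (rule bij_betwI[OF maps]) (auto simp: D_def D'_def)
  have inv: "inv_into D \<Phi> v = \<Psi> v" if "v \<in> D'" for v
    using that bij maps by (intro inv_into_f_eq) (auto simp: bij_betw_def D'_def)
  have "\<Phi> \<in> restrict_space M D \<rightarrow>\<^sub>M restrict_space N D'"
    using \<Phi> maps(1) by (rule measurable_restrict_space3)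
  moreover have "inv_into D \<Phi> \<in> restrict_space N D' \<rightarrow>\<^sub>M restrict_space M D"
  proof (subst measurable_cong)
    show "inv_into D \<Phi> v = \<Psi> v" if "v \<in> space (restrict_space N D')" for v
      using inv that by (simp add: space_restrict_space)
    show "\<Psi> \<in> restrict_space N D' \<rightarrow>\<^sub>M restrict_space M D"
      using \<Psi>(1) maps(2) by (rule measurable_restrict_space3)
  qed
  moreover have "emeasure M E = emeasure N (\<Phi> ` E)" if E: "E \<in> sets M" "E \<subseteq> D" for E
  proof -
    have "\<Phi> ` E = \<Psi> -` E \<inter> D'"
    proof (intro equalityI subsetI)
      fix v assume "v \<in> \<Phi> ` E"
      then show "v \<in> \<Psi> -` E \<inter> D'" using E(2) maps by (auto simp: D_def)
    next
      fix v assume "v \<in> \<Psi> -` E \<inter> D'"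
      then show "v \<in> \<Phi> ` E" by (intro image_eqI[of _ _ "\<Psi> v"]) (auto simp: D'_def)
    qed
    also have "emeasure N (\<Psi> -` E \<inter> D') = emeasure N (\<Psi> -` E \<inter> space N)"
    proof (rule emeasure_eq_AE)
      show "AE v in N. v \<in> \<Psi> -` E \<inter> D' \<longleftrightarrow> v \<in> \<Psi> -` E \<inter> space N"
        using inv2 by (auto simp: D'_def)
      show "\<Psi> -` E \<inter> space N \<in> sets N" using \<Psi>(1) E(1) by (rule measurable_sets)
      then have "(\<Psi> -` E \<inter> space N) \<inter> D' \<in> sets N" using D' by (rule sets.Int)
      also have "(\<Psi> -` E \<inter> space N) \<inter> D' = \<Psi> -` E \<inter> D'" by (auto simp: D'_def)
      finally show "\<Psi> -` E \<inter> D' \<in> sets N" .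
    qed
    also have "\<dots> = emeasure M E" using emeasure_distr[OF \<Psi>(1) E(1)] \<Psi>(2) by simp
    finally show ?thesis ..
  qed
  ultimately show ?thesis
    unfolding iso_mod_null_def using null bij
    by (intro bexI[of _ "space M - D"] bexI[of _ "space N - D'"]) (simp_all add: sub)
qed

section \<open>The spectral measure from the finite-dimensional distributions\<close>

text \<open>
  The functional \<open>A \<mapsto> emeasure Q (g -` A \<inter> space Q)\<close> would give \<open>0\<close> both to a set \<open>A\<close> with
  non-measurable preimage and to its complement, contradicting total mass \<open>1\<close>. The vector of suprema over the
  Poisson points thus becomes measurable, whatever its values on null events, by having the same law
  as a vector of values of \<open>X\<close>.
\<close>
lemma prob_space_distr_imp_measurable:
  assumes g: "g \<in> space Q \<rightarrow> space N" and prob: "prob_space (distr Q N g)"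
  shows "g \<in> Q \<rightarrow>\<^sub>M N"
proof (rule measurableI)
  fix \<omega> assume "\<omega> \<in> space Q"
  then show "g \<omega> \<in> space N" using g by auto
next
  fix B assume B: "B \<in> sets N"
  let ?\<mu> = "\<lambda>A. emeasure Q (g -` A \<inter> space Q)"
  have em: "emeasure (distr Q N g) A =
      (if A \<in> sets N \<and> measure_space (space N) (sets N) ?\<mu> then ?\<mu> A else 0)" for A
    unfolding distr_def by (simp add: emeasure_measure_of_conv sets.sigma_sets_eq)
  have one: "emeasure (distr Q N g) (space N) = 1"
    using prob_space.emeasure_space_1[OF prob] by simp
  then have ms: "measure_space (space N) (sets N) ?\<mu>" using em[of "space N"] by (auto split: if_splits)
  show "g -` B \<inter> space Q \<in> sets Q"
  proof (rule ccontr)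
    assume nB: "g -` B \<inter> space Q \<notin> sets Q"
    have "g -` (space N - B) \<inter> space Q = space Q - (g -` B \<inter> space Q)" using g by auto
    moreover have "space Q - (g -` B \<inter> space Q) \<notin> sets Q"
    proof
      assume "space Q - (g -` B \<inter> space Q) \<in> sets Q"
      then have "space Q - (space Q - (g -` B \<inter> space Q)) \<in> sets Q" by (rule sets.compl_sets)
      also have "space Q - (space Q - (g -` B \<inter> space Q)) = g -` B \<inter> space Q" by auto
      finally show False using nB by simp
    qed
    ultimately have "emeasure (distr Q N g) B = 0" "emeasure (distr Q N g) (space N - B) = 0"
      using em nB by (simp_all add: emeasure_notin_sets)
    moreover have "emeasure (distr Q N g) B + emeasure (distr Q N g) (space N - B)
        = emeasure (distr Q N g) (B \<union> (space N - B))"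
      using B by (intro plus_emeasure) auto
    moreover have "B \<union> (space N - B) = space N" using sets.sets_into_space[OF B] by auto
    ultimately show False using one by simp
  qed
qed

lemma point_count_eq_0_iff:
  "point_count J U B \<omega> = 0 \<longleftrightarrow> (\<forall>i\<in>J \<omega>. U \<omega> i \<notin> B)"
  unfolding point_count_def by (subst emeasure_count_space_eq_0) auto

lemma poisson_void_probability:
  assumes "poisson_point_process Q M J U" "B \<in> sets M" "emeasure M B < \<infinity>"
  shows "{\<omega> \<in> space Q. point_count J U B \<omega> = 0} \<in> sets Q"
    and "measure Q {\<omega> \<in> space Q. point_count J U B \<omega> = 0} = exp (- measure M B)"
proof -
  have [measurable]: "point_count J U B \<in> borel_measurable Q"
    using assms unfolding poisson_point_process_def by blast
  show "{\<omega> \<in> space Q. point_count J U B \<omega> = 0} \<in> sets Q" by measurable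
  have "\<forall>k::nat. measure Q {\<omega> \<in> space Q. point_count J U B \<omega> = of_nat k} =
      exp (- measure M B) * measure M B ^ k / fact k"
    using assms unfolding poisson_point_process_def by blast
  from this[rule_format, of 0]
  show "measure Q {\<omega> \<in> space Q. point_count J U B \<omega> = 0} = exp (- measure M B)" by simp
qed

text \<open>
  The index is a pair, so that the level sets of a whole family of functions form a single family of
  sets.
\<close>
definition level_set :: "'w measure \<Rightarrow> ('t \<Rightarrow> 'w \<Rightarrow> real) \<Rightarrow> 't \<times> real \<Rightarrow> 'w set" where
  "level_set M f k = {w \<in> space M. snd k < f (fst k) w}"

lemma
  assumes f: "\<forall>t\<in>T. f t \<in> Lvee M" and k: "k \<in> T \<times> {0<..}"
  shows sets_level_set: "level_set M f k \<in> sets M"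
    and emeasure_level_set: "emeasure M (level_set M f k) < \<infinity>"
proof -
  have "f (fst k) \<in> Lvee M" "0 < snd k" using f k by auto
  then show "level_set M f k \<in> sets M" "emeasure M (level_set M f k) < \<infinity>"
    unfolding level_set_def Lvee_def by auto
qed

lemma emeasure_Union_level_sets:
  assumes f: "\<forall>t\<in>T. f t \<in> Lvee M" and F: "finite F" "F \<subseteq> T \<times> {0<..}"
  shows "emeasure M (\<Union>k\<in>F. level_set M f k) < \<infinity>"
proof -
  have "emeasure M (\<Union>k\<in>F. level_set M f k) \<le> (\<Sum>k\<in>F. emeasure M (level_set M f k))"
    using F sets_level_set[OF f] by (intro emeasure_subadditive_finite) blast+
  also have "\<dots> < \<infinity>"
    using F emeasure_level_set[OF f] by (auto simp: less_top subset_iff)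
  finally show ?thesis .
qed

text \<open>
  The sets \<open>{f > n + 1}\<close> have finite measure and decrease to the empty set, so the probabilities
  \<open>exp (- \<mu> {f > n + 1})\<close> that they contain no Poisson point tend to \<open>1\<close>. On these events \<open>n + 1\<close> is a
  bound. The lemma guarantees that the real supremum in the extremal integral is a true supremum
  almost surely.
\<close>
lemma poisson_values_bounded:
  assumes PP: "poisson_point_process Q M J U" and f: "f \<in> Lvee M"
  shows "AE \<omega> in Q. bdd_above ((\<lambda>i. f (U \<omega> i)) ` J \<omega>)"
proof -
  interpret Q: prob_space Q using PP unfolding poisson_point_process_def by blast
  have U: "\<And>\<omega> i. \<omega> \<in> space Q \<Longrightarrow> i \<in> J \<omega> \<Longrightarrow> U \<omega> i \<in> space M"
    using PP unfolding poisson_point_process_def by blast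
  define E where "E n = {w \<in> space M. real (Suc n) < f w}" for n
  have fm[measurable]: "f \<in> borel_measurable M" using f unfolding Lvee_def by auto
  have E: "E n \<in> sets M" for n unfolding E_def by measurable
  have finE: "emeasure M (E n) < \<infinity>" for n
    using f unfolding Lvee_def E_def by (auto intro: of_nat_0_less_iff[THEN iffD2])
  have "(\<lambda>n. emeasure M (E n)) \<longlonglongrightarrow> emeasure M (\<Inter>n. E n)"
    using E finE by (intro Lim_emeasure_decseq) (auto simp: decseq_def E_def less_top)
  also have "(\<Inter>n. E n) = {}"
  proof (rule equals0I)
    fix w assume w: "w \<in> (\<Inter>n. E n)"
    obtain n where "f w < real n" using reals_Archimedean2 by blast
    moreover have "real (Suc n) < f w" using w by (auto simp: E_def)
    ultimately show False by simp
  qed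
  finally have lim0: "(\<lambda>n. emeasure M (E n)) \<longlonglongrightarrow> ennreal 0" by simp
  have "(\<lambda>n. measure M (E n)) \<longlonglongrightarrow> 0"
    unfolding measure_def by (rule tendsto_enn2real[OF lim0]) simp
  then have lim1: "(\<lambda>n. exp (- measure M (E n))) \<longlonglongrightarrow> exp (- 0)"
    by (intro tendsto_intros)
  define V where "V n = {\<omega> \<in> space Q. point_count J U (E n) \<omega> = 0}" for n
  have V: "V n \<in> sets Q" "measure Q (V n) = exp (- measure M (E n))" for n
    using poisson_void_probability[OF PP E finE] unfolding V_def by auto
  have UV: "(\<Union>n. V n) \<in> sets Q" using V by auto
  have "exp (- measure M (E n)) \<le> measure Q (\<Union>n. V n)" for n
    using V(2)[of n] Q.finite_measure_mono[of "V n" "\<Union>n. V n"] UV by auto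
  then have "exp (- 0) \<le> measure Q (\<Union>n. V n)"
    by (intro LIMSEQ_le_const2[OF lim1]) auto
  then have "measure Q (\<Union>n. V n) = 1" by (intro antisym Q.prob_le_1) simp
  then have "AE \<omega> in Q. \<omega> \<in> (\<Union>n. V n)" using UV by (subst Q.AE_in_set_eq_1)
  then show ?thesis
  proof (rule AE_mp, intro AE_I2 impI)
    fix \<omega> assume \<omega>: "\<omega> \<in> space Q" "\<omega> \<in> (\<Union>n. V n)"
    then obtain n where "\<forall>i\<in>J \<omega>. U \<omega> i \<notin> E n" by (auto simp: V_def point_count_eq_0_iff)
    then show "bdd_above ((\<lambda>i. f (U \<omega> i)) ` J \<omega>)"
      using U[OF \<omega>(1)] by (intro bdd_aboveI2[where M = "real (Suc n)"]) (auto simp: E_def not_less)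
  qed
qed

lemma extremal_integral_le_iff:
  assumes "bdd_above ((\<lambda>i. f (U \<omega> i)) ` J \<omega>)" "0 \<le> a"
  shows "extremal_integral J U f \<omega> \<le> a \<longleftrightarrow> (\<forall>i\<in>J \<omega>. f (U \<omega> i) \<le> a)"
  using assms by (auto simp: extremal_integral_def cSUP_le_iff)

text \<open>
  Up to null events, the event that the extremal integrals do not exceed the given levels is the event
  that the Poisson process avoids the union of the level sets.
\<close>
lemma spectral_representation_void:
  assumes P: "stochastic_process P T X" and PP: "poisson_point_process Q M J U"
    and rep: "spectral_representation P T X Q J U M f"
    and F: "finite F" "F \<subseteq> T \<times> {0<..}"
  shows "measure P {\<omega> \<in> space P. \<forall>k\<in>F. X (fst k) \<omega> \<le> snd k} = exp (- measure M (\<Union>k\<in>F. level_set M f k))"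
proof -
  interpret P: prob_space P using P unfolding stochastic_process_def by blast
  interpret Q: prob_space Q using PP unfolding poisson_point_process_def by blast
  have U: "\<And>\<omega> i. \<omega> \<in> space Q \<Longrightarrow> i \<in> J \<omega> \<Longrightarrow> U \<omega> i \<in> space M"
    using PP unfolding poisson_point_process_def by blast
  have f: "\<forall>t\<in>T. f t \<in> Lvee M" using rep unfolding spectral_representation_def by blast
  define G where "G = fst ` F"
  have G: "finite G" "G \<subseteq> T" using F by (auto simp: G_def)
  define N where "N = (\<Pi>\<^sub>M t\<in>G. (borel :: real measure))"
  define x where "x \<omega> = (\<lambda>t\<in>G. X t \<omega>)" for \<omega>
  define y where "y \<omega> = (\<lambda>t\<in>G. extremal_integral J U (f t) \<omega>)" for \<omega>
  have law: "distr P N x = distr Q N y"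
    using rep G unfolding spectral_representation_def fdd_eq_def N_def x_def[abs_def] y_def[abs_def] by blast
  have x: "x \<in> P \<rightarrow>\<^sub>M N"
    unfolding N_def x_def[abs_def] using P G(2)
    by (intro measurable_restrict) (auto simp: stochastic_process_def)
  have y: "y \<in> Q \<rightarrow>\<^sub>M N"
  proof (rule prob_space_distr_imp_measurable)
    show "y \<in> space Q \<rightarrow> space N" by (auto simp: y_def N_def space_PiM)
    show "prob_space (distr Q N y)" using P.prob_space_distr[OF x] law by simp
  qed
  define B where "B = {z \<in> space N. \<forall>k\<in>F. z (fst k) \<le> snd k}"
  have B: "B \<in> sets N"
  proof -
    have "{z \<in> space N. z (fst k) \<le> snd k} \<in> sets N" if "k \<in> F" for k
    proof -
      have [measurable]: "(\<lambda>z. z (fst k)) \<in> borel_measurable N"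
        unfolding N_def using that by (intro measurable_component_singleton) (auto simp: G_def)
      show ?thesis by measurable
    qed
    then show ?thesis unfolding B_def using F(1) by (intro sets.sets_Collect_finite_All) auto
  qed
  let ?A = "\<Union>k\<in>F. level_set M f k"
  have A: "?A \<in> sets M"
    using F sets_level_set[OF f] by (intro sets.finite_UN) blast+
  note finA = emeasure_Union_level_sets[OF f F]
  have "AE \<omega> in Q. \<forall>t\<in>G. bdd_above ((\<lambda>i. f t (U \<omega> i)) ` J \<omega>)"
    using G f poisson_values_bounded[OF PP] by (intro AE_finite_allI) blast+
  then have void: "AE \<omega> in Q. y \<omega> \<in> B \<longleftrightarrow> point_count J U ?A \<omega> = 0"
  proof (rule AE_mp, intro AE_I2 impI)
    fix \<omega> assume \<omega>: "\<omega> \<in> space Q" and bdd: "\<forall>t\<in>G. bdd_above ((\<lambda>i. f t (U \<omega> i)) ` J \<omega>)"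
    have "y \<omega> \<in> B \<longleftrightarrow> (\<forall>k\<in>F. extremal_integral J U (f (fst k)) \<omega> \<le> snd k)"
      using measurable_space[OF y \<omega>] by (auto simp: B_def y_def G_def)
    also have "\<dots> \<longleftrightarrow> (\<forall>k\<in>F. \<forall>i\<in>J \<omega>. f (fst k) (U \<omega> i) \<le> snd k)"
      using bdd F(2) by (intro ball_cong refl extremal_integral_le_iff) (auto simp: G_def)
    also have "\<dots> \<longleftrightarrow> point_count J U ?A \<omega> = 0"
      using U[OF \<omega>] by (auto simp: point_count_eq_0_iff level_set_def not_less)
    finally show "y \<omega> \<in> B \<longleftrightarrow> point_count J U ?A \<omega> = 0" .
  qed
  have "measure P {\<omega> \<in> space P. \<forall>k\<in>F. X (fst k) \<omega> \<le> snd k} = measure (distr P N x) B"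
  proof -
    have "x -` B \<inter> space P = {\<omega> \<in> space P. \<forall>k\<in>F. X (fst k) \<omega> \<le> snd k}"
      using measurable_space[OF x] by (auto simp: B_def x_def G_def)
    then show ?thesis using measure_distr[OF x B] by simp
  qed
  also have "\<dots> = measure Q (y -` B \<inter> space Q)" unfolding law using measure_distr[OF y B] by simp
  also have "\<dots> = measure Q {\<omega> \<in> space Q. point_count J U ?A \<omega> = 0}"
    using void measurable_sets[OF y B] poisson_void_probability(1)[OF PP A finA]
    by (intro Q.finite_measure_eq_AE) auto
  also have "\<dots> = exp (- measure M ?A)" by (rule poisson_void_probability(2)[OF PP A finA])
  finally show ?thesis .
qed

lemma spectral_representations_level_sets:
  assumes P: "stochastic_process P T X"
    and PP1: "poisson_point_process Q1 M1 J1 U1" and rep1: "spectral_representation P T X Q1 J1 U1 M1 f1"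
    and PP2: "poisson_point_process Q2 M2 J2 U2" and rep2: "spectral_representation P T X Q2 J2 U2 M2 f2"
    and F: "finite F" "F \<subseteq> T \<times> {0<..}"
  shows "emeasure M1 (\<Union>k\<in>F. level_set M1 f1 k) = emeasure M2 (\<Union>k\<in>F. level_set M2 f2 k)"
proof -
  have "exp (- measure M1 (\<Union>k\<in>F. level_set M1 f1 k)) = exp (- measure M2 (\<Union>k\<in>F. level_set M2 f2 k))"
    using spectral_representation_void[OF P PP1 rep1 F] spectral_representation_void[OF P PP2 rep2 F] by simp
  moreover have "emeasure M1 (\<Union>k\<in>F. level_set M1 f1 k) < \<infinity>" "emeasure M2 (\<Union>k\<in>F. level_set M2 f2 k) < \<infinity>"
    using rep1 rep2 unfolding spectral_representation_def
    by (blast intro: emeasure_Union_level_sets[OF _ F])+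
  ultimately show ?thesis by (simp add: emeasure_eq_ennreal_measure less_top)
qed

section \<open>Minimal spectral representations\<close>

text \<open>
  Every family of measurable sets has an essential union that is the union of a countable subfamily.
  With respect to an equivalent finite measure \<open>\<nu>\<close>, choose a countable subfamily whose union has
  the largest possible measure; any \<open>E k\<close> that added mass to it would contradict maximality.
\<close>
lemma (in sigma_finite_measure) countable_essential_union:
  assumes E: "\<And>k. k \<in> K \<Longrightarrow> E k \<in> sets M"
  obtains C where "countable C" "C \<subseteq> K" "\<forall>k\<in>K. AE w in M. w \<in> E k \<longrightarrow> (\<exists>j\<in>C. w \<in> E j)"
proof -
  obtain h where h[measurable]: "h \<in> borel_measurable M" and hfin: "integral\<^sup>N M h \<noteq> \<infinity>"
    and hpos: "\<forall>x\<in>space M. 0 < h x \<and> h x < \<infinity>"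
    using Ex_finite_integrable_function by blast
  define \<nu> where "\<nu> = density M h"
  have sets_\<nu>[simp]: "sets \<nu> = sets M" by (simp add: \<nu>_def)
  have fin: "emeasure \<nu> A \<noteq> \<infinity>" if "A \<in> sets M" for A
  proof -
    have "emeasure \<nu> A \<le> emeasure \<nu> (space \<nu>)" by (rule emeasure_space)
    also have "emeasure \<nu> (space \<nu>) = integral\<^sup>N M h"
      unfolding \<nu>_def by (simp add: emeasure_density cong: nn_integral_cong)
    finally show ?thesis using hfin by (auto simp: top_unique)
  qed
  have Esets: "(\<Union>k\<in>C. E k) \<in> sets M" if "countable C" "C \<subseteq> K" for C
    using that E by (intro sets.countable_UN'') auto
  define \<S> where "\<S> = (\<lambda>C. emeasure \<nu> (\<Union>k\<in>C. E k)) ` {C. countable C \<and> C \<subseteq> K}"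
  have "\<S> \<noteq> {}" unfolding \<S>_def by blast
  then obtain s :: "nat \<Rightarrow> ennreal" where s: "range s \<subseteq> \<S>" "Sup \<S> = (SUP i. s i)"
    using ennreal_Sup_countable_SUP by metis
  have "\<exists>C. \<forall>i. (countable (C i) \<and> C i \<subseteq> K) \<and> s i = emeasure \<nu> (\<Union>k\<in>C i. E k)"
    by (rule choice) (use s(1) in \<open>auto simp: \<S>_def\<close>)
  then obtain C where C: "\<forall>i. (countable (C i) \<and> C i \<subseteq> K) \<and> s i = emeasure \<nu> (\<Union>k\<in>C i. E k)" ..
  define D where "D = (\<Union>i. C i)"
  have D: "countable D" "D \<subseteq> K" using C by (auto simp: D_def)
  let ?U = "\<Union>k\<in>D. E k"
  have "s i \<le> emeasure \<nu> ?U" for i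
    unfolding C[rule_format, THEN conjunct2] using Esets[OF D] by (intro emeasure_mono) (auto simp: D_def)
  then have max: "Sup \<S> \<le> emeasure \<nu> ?U" unfolding s(2) by (intro SUP_least)
  show thesis
  proof (rule that[OF D], rule ballI)
    fix k assume k: "k \<in> K"
    have "emeasure \<nu> (E k \<union> ?U) \<in> \<S>"
      unfolding \<S>_def using D k by (intro image_eqI[of _ _ "insert k D"]) auto
    then have le: "emeasure \<nu> (E k \<union> ?U) \<le> emeasure \<nu> ?U" using max Sup_upper order_trans by blast
    have "emeasure \<nu> (E k - ?U) = emeasure \<nu> ((E k \<union> ?U) - ?U)" by (rule arg_cong[where f = "emeasure \<nu>"]) auto
    also have "\<dots> = emeasure \<nu> (E k \<union> ?U) - emeasure \<nu> ?U"
      using E[OF k] Esets[OF D] fin by (intro emeasure_Diff) auto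
    also have "\<dots> = 0" using le fin[OF Esets[OF D]] by (simp add: diff_eq_0_iff_ennreal less_top)
    finally have "E k - ?U \<in> null_sets \<nu>" using E[OF k] Esets[OF D] by (auto intro: null_setsI)
    then have "AE w in \<nu>. w \<notin> E k - ?U" by (rule AE_not_in)
    then have "AE w in M. 0 < h w \<longrightarrow> w \<notin> E k - ?U" unfolding \<nu>_def by (subst (asm) AE_density) auto
    then show "AE w in M. w \<in> E k \<longrightarrow> (\<exists>j\<in>D. w \<in> E j)"
      using hpos by (auto elim!: AE_mp intro!: AE_I2)
  qed
qed

text \<open>
  On the complement of the essential union of the level sets every \<open>f t\<close> vanishes almost everywhere,
  so the full support condition makes this complement a null set.
\<close>
lemma minimal_family_countable_cover:
  assumes "sigma_finite_measure M" and f: "\<forall>t\<in>T. f t \<in> Lvee M" and min: "minimal_family M T f"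
  obtains C where "countable C" "C \<subseteq> T \<times> {0<..}" "AE w in M. \<exists>k\<in>C. w \<in> level_set M f k"
proof -
  interpret sigma_finite_measure M by fact
  obtain C where C: "countable C" "C \<subseteq> T \<times> {0<..}"
    and ess: "\<forall>k\<in>T \<times> {0<..}. AE w in M. w \<in> level_set M f k \<longrightarrow> (\<exists>j\<in>C. w \<in> level_set M f j)"
    by (rule countable_essential_union[of "T \<times> {0<..}" "level_set M f", OF sets_level_set[OF f]])
  define B where "B = space M - (\<Union>k\<in>C. level_set M f k)"
  have "level_set M f k \<in> sets M" if "k \<in> C" for k
    using that C(2) sets_level_set[OF f] by blast
  then have B: "B \<in> sets M"
    unfolding B_def using C(1) by (intro sets.Diff sets.top sets.countable_UN'')
  have "AE w in M. w \<in> B \<longrightarrow> f t w = 0" if t: "t \<in> T" for t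
  proof -
    have "AE w in M. \<forall>n. w \<in> level_set M f (t, 1 / real (Suc n)) \<longrightarrow> (\<exists>j\<in>C. w \<in> level_set M f j)"
      unfolding AE_all_countable using t by (intro allI bspec[OF ess]) auto
    moreover have "AE w in M. 0 \<le> f t w" using f t unfolding Lvee_def by blast
    ultimately show ?thesis
    proof eventually_elim
      case (elim w)
      show ?case
      proof (intro impI antisym elim(2), rule ccontr)
        assume w: "w \<in> B" and "\<not> f t w \<le> 0"
        then obtain n where "1 / Suc n < f t w" using nat_approx_posE[of "f t w"] by auto
        then have "w \<in> level_set M f (t, 1 / real (Suc n))" using w by (auto simp: level_set_def B_def)
        then show False using elim(1) w by (auto simp: B_def)
      qed
    qed
  qed
  then have "emeasure M B = 0" using min B unfolding minimal_family_def by (auto simp: not_gr_zero)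
  then have "AE w in M. w \<notin> B" using B by (intro AE_not_in null_setsI)
  then have "AE w in M. \<exists>k\<in>C. w \<in> level_set M f k"
    by (rule AE_mp) (auto simp: B_def intro!: AE_I2)
  then show thesis by (rule that[OF C])
qed

text \<open>
  Only levels \<open>a > 0\<close> occur in the family, and they see only the positive part of \<open>f t\<close>. The positive
  part is measurable with respect to the \<open>\<sigma>\<close>-algebra of the level sets and is a version of \<open>f t\<close>.
\<close>
lemma minimal_family_generates:
  assumes f: "\<forall>t\<in>T. f t \<in> Lvee M" and min: "minimal_family M T f"
  shows "generates_mod_null M (T \<times> {0<..}) (level_set M f)"
proof -
  let ?K = "T \<times> {0<..} :: ('a \<times> real) set"
  let ?L = "sigma_sets (space M) (level_set M f ` ?K)"
  define N where "N = sigma (space M) (level_set M f ` ?K)"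
  have gen_sub: "level_set M f ` ?K \<subseteq> Pow (space M)" by (auto simp: level_set_def)
  have N: "space N = space M" "sets N = ?L"
    unfolding N_def using gen_sub by (simp_all add: space_measure_of sets_measure_of)
  have pos_meas: "(\<lambda>w. max 0 (f t w)) \<in> borel_measurable N" if t: "t \<in> T" for t
  proof (rule borel_measurableI_greater)
    have lev: "level_set M f (t, a) \<in> sets N" if "0 < a" for a
      unfolding N using t that by (intro sigma_sets.Basic imageI) auto
    fix a :: real
    consider "a < 0" | "a = 0" | "0 < a" by linarith
    then show "{w \<in> space N. a < max 0 (f t w)} \<in> sets N"
    proof cases
      case 1
      then have "{w \<in> space N. a < max 0 (f t w)} = space N" by auto
      then show ?thesis by simp
    next
      case 2
      have "{w \<in> space N. a < max 0 (f t w)} = (\<Union>n. level_set M f (t, 1 / real (Suc n)))"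
      proof (intro equalityI subsetI)
        fix w assume w: "w \<in> {w \<in> space N. a < max 0 (f t w)}"
        then have "0 < f t w" using 2 by auto
        then obtain n where "1 / Suc n < f t w" using nat_approx_posE by blast
        then show "w \<in> (\<Union>n. level_set M f (t, 1 / real (Suc n)))" using w by (auto simp: level_set_def N)
      next
        fix w assume "w \<in> (\<Union>n. level_set M f (t, 1 / real (Suc n)))"
        then obtain n where "w \<in> space M" "1 / real (Suc n) < f t w" by (auto simp: level_set_def)
        moreover have "0 < 1 / real (Suc n)" by simp
        ultimately have "0 < f t w" by linarith
        then show "w \<in> {w \<in> space N. a < max 0 (f t w)}" using 2 \<open>w \<in> space M\<close> by (auto simp: N)
      qed
      also have "\<dots> \<in> sets N" by (intro sets.countable_UN) (auto intro!: lev)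
      finally show ?thesis .
    next
      case 3
      then have "{w \<in> space N. a < max 0 (f t w)} = level_set M f (t, a)" by (auto simp: level_set_def N)
      then show ?thesis using lev 3 by simp
    qed
  qed
  have approx: "\<exists>B\<in>?L. AE w in M. w \<in> A \<longleftrightarrow> w \<in> B" if "A \<in> generated_sigma M T f" for A
    using that unfolding generated_sigma_def
  proof induction
    case (Basic A)
    then obtain t S where tS: "A = f t -` S \<inter> space M" "t \<in> T" "S \<in> sets borel" by blast
    have "(\<lambda>w. max 0 (f t w)) -` S \<inter> space M \<in> ?L"
      using measurable_sets[OF pos_meas[OF tS(2)] tS(3)] by (simp add: N)
    moreover have "AE w in M. w \<in> A \<longleftrightarrow> w \<in> (\<lambda>w. max 0 (f t w)) -` S \<inter> space M"
    proof -
      have "AE w in M. 0 \<le> f t w" using f tS(2) unfolding Lvee_def by blast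
      then show ?thesis by eventually_elim (auto simp: tS(1) max_def)
    qed
    ultimately show ?case by blast
  next
    case Empty
    show ?case by (intro bexI[of _ "{}"] sigma_sets.Empty) simp
  next
    case (Compl A)
    then obtain B where B: "B \<in> ?L" "AE w in M. w \<in> A \<longleftrightarrow> w \<in> B" by blast
    from B(2) have "AE w in M. w \<in> space M - A \<longleftrightarrow> w \<in> space M - B" by eventually_elim auto
    then show ?case using sigma_sets.Compl[OF B(1)] by blast
  next
    case (Union A)
    have "\<exists>B. \<forall>i. B i \<in> ?L \<and> (AE w in M. w \<in> A i \<longleftrightarrow> w \<in> B i)"
      by (rule choice) (use Union.IH in blast)
    then obtain B where B_spec: "\<forall>i. B i \<in> ?L \<and> (AE w in M. w \<in> A i \<longleftrightarrow> w \<in> B i)" ..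
    have B: "B i \<in> ?L" "AE w in M. w \<in> A i \<longleftrightarrow> w \<in> B i" for i using B_spec by blast+
    have "AE w in M. \<forall>i. w \<in> A i \<longleftrightarrow> w \<in> B i" unfolding AE_all_countable using B(2) by blast
    then have "AE w in M. w \<in> (\<Union>i. A i) \<longleftrightarrow> w \<in> (\<Union>i. B i)" by eventually_elim auto
    then show ?case using sigma_sets.Union[of B, OF B(1)] by blast
  qed
  show ?thesis unfolding generates_mod_null_def
  proof
    fix B assume B: "B \<in> sets M"
    obtain A where A: "A \<in> generated_sigma M T f" "emeasure M (sym_diff A B) = 0"
      using min B unfolding minimal_family_def by blast
    have "f t \<in> borel_measurable M" if "t \<in> T" for t using f that unfolding Lvee_def by blast
    then have "A \<in> sets M"
      using A(1) unfolding generated_sigma_def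
      by (rule_tac subsetD[OF sets.sigma_sets_subset]) (auto intro: measurable_sets)
    then have "sym_diff A B \<in> null_sets M" using A(2) B by (intro null_setsI) auto
    then have AB: "AE w in M. w \<notin> sym_diff A B" by (rule AE_not_in)
    obtain A' where A': "A' \<in> ?L" "AE w in M. w \<in> A \<longleftrightarrow> w \<in> A'" using approx[OF A(1)] by blast
    from AB A'(2) have "AE w in M. w \<in> B \<longleftrightarrow> w \<in> A'" by eventually_elim auto
    then show "\<exists>A\<in>?L. AE w in M. w \<in> B \<longleftrightarrow> w \<in> A" using A'(1) by blast
  qed
qed

section \<open>Intertwining maps\<close>

text \<open>
  Two nonnegative numbers are equal if the same positive rationals lie below them, so countably
  many level sets decide whether \<open>f2 t w = f1 t (\<Phi> w)\<close>.
\<close>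
lemma intertwining_map_from_level_sets:
  assumes f1: "\<forall>t\<in>T. f1 t \<in> Lvee M1" and f2: "\<forall>t\<in>T. f2 t \<in> Lvee M2"
    and \<Phi>: "\<Phi> \<in> M2 \<rightarrow>\<^sub>M M1" "distr M2 M1 \<Phi> = M1"
    and lev: "\<And>k. k \<in> T \<times> {0<..} \<Longrightarrow> AE w in M2. w \<in> level_set M2 f2 k \<longleftrightarrow> \<Phi> w \<in> level_set M1 f1 k"
  shows "intertwining_map T M1 f1 M2 f2 \<Phi>"
  unfolding intertwining_map_def
proof (intro conjI ballI \<Phi>)
  fix t assume t: "t \<in> T"
  have "AE w in M2. \<forall>r::rat. 0 < r \<longrightarrow>
      (w \<in> level_set M2 f2 (t, of_rat r) \<longleftrightarrow> \<Phi> w \<in> level_set M1 f1 (t, of_rat r))"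
    unfolding AE_all_countable
  proof
    fix r :: rat
    show "AE w in M2. 0 < r \<longrightarrow>
        (w \<in> level_set M2 f2 (t, of_rat r) \<longleftrightarrow> \<Phi> w \<in> level_set M1 f1 (t, of_rat r))"
      using lev[of "(t, of_rat r)"] t by (cases "0 < r") auto
  qed
  moreover have "AE w in M2. 0 \<le> f2 t w" using f2 t unfolding Lvee_def by blast
  moreover have "AE v in M1. 0 \<le> f1 t v" using f1 t unfolding Lvee_def by blast
  then have "AE w in M2. 0 \<le> f1 t (\<Phi> w)" by (rule AE_preserving[OF \<Phi>])
  moreover have "AE w in M2. w \<in> space M2 \<and> \<Phi> w \<in> space M1"
    using measurable_space[OF \<Phi>(1)] by (intro AE_I2) auto
  ultimately show "AE w in M2. f2 t w = f1 t (\<Phi> w)"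
  proof eventually_elim
    case (elim w)
    have iff: "of_rat r < f2 t w \<longleftrightarrow> of_rat r < f1 t (\<Phi> w)" if "0 < r" for r :: rat
      using elim that by (auto simp: level_set_def)
    have no_gap: False
      if "0 \<le> a" "a < b" "\<And>r::rat. 0 < r \<Longrightarrow> of_rat r < a \<longleftrightarrow> of_rat r < b" for a b :: real
    proof -
      obtain r where r: "a < of_rat r" "of_rat r < b" using of_rat_dense[OF \<open>a < b\<close>] by blast
      then have "0 < r" using \<open>0 \<le> a\<close> by (metis le_less_trans zero_less_of_rat_iff)
      then show False using that(3)[of r] r by simp
    qed
    show ?case
      using no_gap[of "f2 t w" "f1 t (\<Phi> w)"] no_gap[of "f1 t (\<Phi> w)" "f2 t w"] iff elim
      by (meson linorder_neqE)
  qed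
qed

lemma intertwining_map_exists:
  assumes P: "stochastic_process P T X"
    and sf1: "sigma_finite_measure M1" and sf2: "sigma_finite_measure M2"
    and PP1: "poisson_point_process Q1 M1 J1 U1" and PP2: "poisson_point_process Q2 M2 J2 U2"
    and rep1: "spectral_representation P T X Q1 J1 U1 M1 f1" and min1: "minimal_family M1 T f1"
    and rep2: "spectral_representation P T X Q2 J2 U2 M2 f2" and min2: "minimal_family M2 T f2"
    and M1: "borel_space M1"
  obtains \<Phi> where "intertwining_map T M1 f1 M2 f2 \<Phi>"
proof -
  let ?K = "T \<times> {0<..} :: (_ \<times> real) set"
  have f1: "\<forall>t\<in>T. f1 t \<in> Lvee M1" and f2: "\<forall>t\<in>T. f2 t \<in> Lvee M2"
    using rep1 rep2 unfolding spectral_representation_def by blast+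
  obtain C1 where C1: "countable C1" "C1 \<subseteq> ?K" "AE w in M1. \<exists>k\<in>C1. w \<in> level_set M1 f1 k"
    by (rule minimal_family_countable_cover[OF sf1 f1 min1])
  obtain C2 where C2: "countable C2" "C2 \<subseteq> ?K" "AE w in M2. \<exists>k\<in>C2. w \<in> level_set M2 f2 k"
    by (rule minimal_family_countable_cover[OF sf2 f2 min2])
  have law: "distr M1 (membership_space ?K) (membership ?K (level_set M1 f1))
      = distr M2 (membership_space ?K) (membership ?K (level_set M2 f2))"
  proof (rule membership_law_cong[where C = "C1 \<union> C2"])
    show "AE w in M1. \<exists>k\<in>C1 \<union> C2. w \<in> level_set M1 f1 k" using C1(3) by eventually_elim blast
    show "AE w in M2. \<exists>k\<in>C1 \<union> C2. w \<in> level_set M2 f2 k" using C2(3) by eventually_elim blast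
    show "emeasure M1 (\<Union>k\<in>F. level_set M1 f1 k) = emeasure M2 (\<Union>k\<in>F. level_set M2 f2 k)"
      if "finite F" "F \<subseteq> ?K" for F
      by (rule spectral_representations_level_sets[OF P PP1 rep1 PP2 rep2 that])
  qed (use C1 C2 in \<open>simp_all add: sets_level_set[OF f1] sets_level_set[OF f2] emeasure_level_set[OF f1, simplified]\<close>)
  show thesis
  proof (rule equal_laws_imp_point_map[OF M1 minimal_family_generates[OF f1 min1]
        sets_level_set[OF f1] sets_level_set[OF f2] law])
    fix \<Phi> assume "\<Phi> \<in> M2 \<rightarrow>\<^sub>M M1" "distr M2 M1 \<Phi> = M1"
      "\<And>k. k \<in> ?K \<Longrightarrow> AE w in M2. w \<in> level_set M2 f2 k \<longleftrightarrow> \<Phi> w \<in> level_set M1 f1 k"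
    then show thesis by (intro that intertwining_map_from_level_sets[OF f1 f2])
  qed
qed

text \<open>
  Applied to two intertwining maps this is the uniqueness claim; applied to a round trip and the
  identity it makes intertwining maps in opposite directions mutually inverse almost everywhere.
\<close>
lemma measure_preserving_unique:
  assumes f: "\<forall>t\<in>T. f t \<in> Lvee N" and min: "minimal_family N T f" and N: "borel_space N"
    and \<Phi>: "\<Phi> \<in> M \<rightarrow>\<^sub>M N" "distr M N \<Phi> = N" and \<Psi>: "\<Psi> \<in> M \<rightarrow>\<^sub>M N" "distr M N \<Psi> = N"
    and eq: "\<And>t. t \<in> T \<Longrightarrow> AE w in M. f t (\<Phi> w) = f t (\<Psi> w)"
  shows "AE w in M. \<Phi> w = \<Psi> w"
proof (rule point_map_unique[OF minimal_family_generates[OF f min] sets_level_set[OF f]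
      borel_space_countably_separated[OF N] \<Phi> \<Psi>])
  fix k :: "_ \<times> real" assume "k \<in> T \<times> {0<..}"
  then have "AE w in M. f (fst k) (\<Phi> w) = f (fst k) (\<Psi> w)" using eq by auto
  moreover have "AE w in M. \<Phi> w \<in> space N \<and> \<Psi> w \<in> space N"
    using measurable_space[OF \<Phi>(1)] measurable_space[OF \<Psi>(1)] by (intro AE_I2) auto
  ultimately show "AE w in M. \<Phi> w \<in> level_set N f k \<longleftrightarrow> \<Psi> w \<in> level_set N f k"
    by eventually_elim (auto simp: level_set_def)
qed

lemma intertwining_map_round_trip:
  assumes f2: "\<forall>t\<in>T. f2 t \<in> Lvee M2" and min2: "minimal_family M2 T f2" and M2: "borel_space M2"
    and \<Phi>: "intertwining_map T M1 f1 M2 f2 \<Phi>" and \<Psi>: "intertwining_map T M2 f2 M1 f1 \<Psi>"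
  shows "AE w in M2. \<Psi> (\<Phi> w) = w"
proof (rule measure_preserving_unique[OF f2 min2 M2])
  have \<Phi>': "\<Phi> \<in> M2 \<rightarrow>\<^sub>M M1" "distr M2 M1 \<Phi> = M1" and \<Psi>': "\<Psi> \<in> M1 \<rightarrow>\<^sub>M M2" "distr M1 M2 \<Psi> = M2"
    using \<Phi> \<Psi> unfolding intertwining_map_def by blast+
  show "(\<lambda>w. \<Psi> (\<Phi> w)) \<in> M2 \<rightarrow>\<^sub>M M2" using \<Phi>'(1) \<Psi>'(1) by (rule measurable_compose)
  show "distr M2 M2 (\<lambda>w. \<Psi> (\<Phi> w)) = M2"
    using distr_distr[OF \<Psi>'(1) \<Phi>'(1)] \<Phi>'(2) \<Psi>'(2) by (simp add: comp_def)
  show "(\<lambda>w. w) \<in> M2 \<rightarrow>\<^sub>M M2" "distr M2 M2 (\<lambda>w. w) = M2" by (simp_all add: distr_id2)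
  fix t assume t: "t \<in> T"
  have "AE v in M1. f1 t v = f2 t (\<Psi> v)" using \<Psi> t unfolding intertwining_map_def by blast
  then have "AE w in M2. f1 t (\<Phi> w) = f2 t (\<Psi> (\<Phi> w))" by (rule AE_preserving[OF \<Phi>'])
  moreover have "AE w in M2. f2 t w = f1 t (\<Phi> w)" using \<Phi> t unfolding intertwining_map_def by blast
  ultimately show "AE w in M2. f2 t (\<Psi> (\<Phi> w)) = f2 t w" by eventually_elim simp
qed

theorem theorem2p11:
  fixes P :: "'p measure" and T :: "'t set" and X :: "'t \<Rightarrow> 'p \<Rightarrow> real"
    and M1 :: "'a measure" and f1 :: "'t \<Rightarrow> 'a \<Rightarrow> real"
    and M2 :: "'b measure" and f2 :: "'t \<Rightarrow> 'b \<Rightarrow> real"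
    and Q1 :: "'q1 measure" and J1 :: "'q1 \<Rightarrow> nat set" and U1 :: "'q1 \<Rightarrow> nat \<Rightarrow> 'a"
    and Q2 :: "'q2 measure" and J2 :: "'q2 \<Rightarrow> nat set" and U2 :: "'q2 \<Rightarrow> nat \<Rightarrow> 'b"
  assumes "max_id P T X"
    and "\<forall>t\<in>T. essinf P (X t) = 0"
    and "sigma_finite_measure M1" and "sigma_finite_measure M2"
    and "poisson_point_process Q1 M1 J1 U1" and "poisson_point_process Q2 M2 J2 U2"
    and "spectral_representation P T X Q1 J1 U1 M1 f1" and "minimal_family M1 T f1"
    and "spectral_representation P T X Q2 J2 U2 M2 f2" and "minimal_family M2 T f2"
  shows "(borel_space M1 \<longrightarrow> (\<exists>\<Phi>. intertwining_map T M1 f1 M2 f2 \<Phi>)) \<and>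
    (borel_space M1 \<and> borel_space M2 \<longrightarrow>
       (\<forall>\<Phi>. intertwining_map T M1 f1 M2 f2 \<Phi> \<longrightarrow> iso_mod_null M2 M1 \<Phi>) \<and>
       (\<forall>\<Phi> \<Psi>. intertwining_map T M1 f1 M2 f2 \<Phi> \<and> intertwining_map T M1 f1 M2 f2 \<Psi> \<longrightarrow>
          (AE w in M2. \<Phi> w = \<Psi> w)))"
proof -
  have P: "stochastic_process P T X" using assms(1) unfolding max_id_def by blast
  have f1: "\<forall>t\<in>T. f1 t \<in> Lvee M1" and f2: "\<forall>t\<in>T. f2 t \<in> Lvee M2"
    using assms(7,9) unfolding spectral_representation_def by blast+
  have "\<exists>\<Phi>. intertwining_map T M1 f1 M2 f2 \<Phi>" if "borel_space M1"
    using intertwining_map_exists[OF P assms(3-10) that] by blast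
  moreover have "iso_mod_null M2 M1 \<Phi>"
    if M1: "borel_space M1" and M2: "borel_space M2" and \<Phi>: "intertwining_map T M1 f1 M2 f2 \<Phi>" for \<Phi>
  proof -
    obtain \<Psi> where \<Psi>: "intertwining_map T M2 f2 M1 f1 \<Psi>"
      by (rule intertwining_map_exists[OF P assms(4,3,6,5,9,10,7,8) M2])
    show ?thesis
    proof (rule inverse_pair_iso_mod_null)
      show "AE w in M2. \<Psi> (\<Phi> w) = w"
        by (rule intertwining_map_round_trip[OF f2 assms(10) M2 \<Phi> \<Psi>])
      show "AE v in M1. \<Phi> (\<Psi> v) = v"
        by (rule intertwining_map_round_trip[OF f1 assms(8) M1 \<Psi> \<Phi>])
      show "\<Phi> \<in> M2 \<rightarrow>\<^sub>M M1" using \<Phi> unfolding intertwining_map_def by blast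
      show "\<Psi> \<in> M1 \<rightarrow>\<^sub>M M2" "distr M1 M2 \<Psi> = M2"
        using \<Psi> unfolding intertwining_map_def by blast+
    qed (use M1 M2 borel_space_countably_separated in blast)+
  qed
  moreover have "AE w in M2. \<Phi> w = \<Psi> w"
    if M1: "borel_space M1" and \<Phi>: "intertwining_map T M1 f1 M2 f2 \<Phi>"
      and \<Psi>: "intertwining_map T M1 f1 M2 f2 \<Psi>" for \<Phi> \<Psi>
  proof (rule measure_preserving_unique[OF f1 assms(8) M1])
    show "\<Phi> \<in> M2 \<rightarrow>\<^sub>M M1" "distr M2 M1 \<Phi> = M1" "\<Psi> \<in> M2 \<rightarrow>\<^sub>M M1" "distr M2 M1 \<Psi> = M1"
      using \<Phi> \<Psi> unfolding intertwining_map_def by blast+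
    fix t assume "t \<in> T"
    then have "AE w in M2. f2 t w = f1 t (\<Phi> w)" "AE w in M2. f2 t w = f1 t (\<Psi> w)"
      using \<Phi> \<Psi> unfolding intertwining_map_def by blast+
    then show "AE w in M2. f1 t (\<Phi> w) = f1 t (\<Psi> w)" by eventually_elim simp
  qed
  ultimately show ?thesis by blast
qed

end
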